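(* Let $\mathcal{N}_2$ be the germ $(\mathbb{C}^2,0)$, with coordinates $(t_1,t_2)$, equipped with the multiplication $\circ$ on its tangent bundle with unit field $\partial_1$ and $\partial_2\circ\partial_2=0$. Let $$C_1=\mathrm{Id}_2,\quad C_2=\begin{pmatrix}0&0\\1&0\end{pmatrix},\quad E=\begin{pmatrix}0&1\\0&0\end{pmatrix}.$$ A function $f\in\mathbb{C}\{t_2,z\}$ is called associated to a (holomorphic) $(T)$-structure over $\mathcal{N}_2$ if the $(T)$-structure is holomorphically isomorphic to the $(T)$-structure $A_1=C_1$, $A_2=C_2+zfE$. Write $f=\sum_{n\geq0}f(n)z^n$ with $f(n)\in\mathbb{C}\{t_2\}$. Let $(H,\nabla)$ be an arbitrary $(T)$-structure over $\mathcal{N}_2$. (i) The order $\mathrm{ord}_0f(0)\in\mathbb{Z}_{\geq0}\cup\{\infty\}$ of an associated function $f$ is a formal invariant of $(H,\nabla)$ (with $\mathrm{ord}_0f(0):=\infty$ when $f(0)=0$); that is, if two $(T)$-structures over $\mathcal{N}_2$ are formally isomorphic and $f,\tilde f$ are functions associated to the first and second respectively, then $\mathrm{ord}_0f(0)=\mathrm{ord}_0\tilde f(0)$. (ii) If some associated function $\tilde f$ of $(H,\nabla)$ satisfies $\tilde f(0)=0$, then there is an associated function $f$ of $(H,\nabla)$ with $f(0)=0$ and $f(1)=0$. (iii) If an associated function $\tilde f$ of $(H,\nabla)$ has $r=\mathrm{ord}_0\tilde f(0)\in\mathbb{Z}_{\geq0}$, then there is an associated function $f$ of $(H,\nabla)$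 with $f(0)=t_2^r$.
   Context: Rings: $t=(t_1,t_2)$; $\mathbb{C}\{t_2\}$, $\mathbb{C}\{t,z\}$, $\mathbb{C}\{t_2,z\}$ are rings of convergent power series. $\mathbb{C}\{t,z]]$ is the ring of formal power series $\sum_{n\geq 0}a_n z^n$ with all $a_n=a_n(t)$ holomorphic on the same neighbourhood of $0$. $\mathrm{ord}_0$ denotes the vanishing order at $t_2=0$. For a matrix $A$ with entries in these rings write $A=\sum_{n\geq0}A(n)z^n$ with $A(n)$ independent of $z$. $(T)$-structures: a $(T)$-structure over a complex manifold $M$ is a holomorphic vector bundle $H\to\mathbb{C}\times M$ with a map $\nabla:\mathcal{O}(H)\to\frac1z\mathcal{O}_{\mathbb{C}\times M}\cdot\Omega^1_M\otimes\mathcal{O}(H)$ whose restriction to $H|_{\{z\}\times M}$ is a flat connection for every $z\in\mathbb{C}^*$. Over the germ $M=(\mathbb{C}^2,0)$ the bundle $H$ (a germ along $(0,0)\in\mathbb{C}\times\mathbb{C}^2$) is assumed trivial; in the rank 2 case, in a trivialization $\underline{s}=(s_1,s_2)$, one has $\nabla\underline{s}=\underline{s}\cdot\frac1z(A_1dt_1+A_2dt_2)$ with $A_1,A_2\in M_{2\times2}(\mathbb{C}\{t,z\})$, and flatness means $z\partial_1A_2-z\partial_2A_1+[A_1,A_2]=0$. So a $(T)$-structure is given by such a pair $(A_1,A_2)$. Unfolding condition and induced multiplication: on $K=H|_{\{0\}\times M}$ one has the Higgs field $C_{\partial_i}=A_i(0)$ (these commute). The $(T)$-structure satisfies the unfolding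 condition if there is a section $\zeta\in\mathcal{O}(K)$ such that $X\mapsto C_X\zeta$ is an isomorphism $TM\to K$. It then induces a well-defined multiplication on $TM$ by $C_{X\circ Y}\zeta=C_XC_Y\zeta$, whose unit field $e$ is determined by $C_e\zeta=\zeta$. A $(T)$-structure "over $\mathcal{N}_2$" means a $(T)$-structure over $(\mathbb{C}^2,0)$ which satisfies the unfolding condition and induces the multiplication and unit field of $\mathcal{N}_2$. Isomorphisms: a holomorphic (respectively formal) isomorphism from $(\tilde A_1,\tilde A_2)$ to $(A_1,A_2)$ covering a germ of biholomorphic map $h=(h^1,h^2):(\mathbb{C}^2,0)\to(\mathbb{C}^2,0)$ is given by a matrix $\tilde T$ with entries in $\mathbb{C}\{t,z\}$ (respectively $\mathbb{C}\{t,z]]$), with $\tilde T(0)$ invertible, such that for $i=1,2$ $$z\partial_i\tilde T+\sum_{j=1}^2(\partial_ih^j)(A_j\circ h)\tilde T-\tilde T\tilde A_i=0,$$ where $A_j\circ h$ means $A_j(z,h(t))$. Two $(T)$-structures are holomorphically (formally) isomorphic if such an isomorphism exists for some $h$. *)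

theory Defs
  imports "HOL-Complex_Analysis.Complex_Analysis" "HOL-Library.Extended_Nat"
begin

unbundle no fps_syntax

(* Points of M = (C^2,0) are t :: complex^2, points of C \<times> M are pairs (z, t).  A germ is
   represented by a total function; only its values near the origin matter, and equality of
   germs is equality on a neighbourhood of the origin.  A function of several complex variables
   is holomorphic if it is complex differentiable, i.e. its Frechet derivative is C-linear. *)

definition holM_on :: "(complex^2) set \<Rightarrow> (complex^2 \<Rightarrow> complex) \<Rightarrow> bool" where
  "holM_on U g \<longleftrightarrow> open U \<and>
     (\<forall>t\<in>U. \<exists>d. (g has_derivative (\<lambda>v. \<Sum>i\<in>UNIV. d $ i * v $ i)) (at t))"

definition holCM_on :: "(complex \<times> (complex^2)) set \<Rightarrow> (complex \<times> (complex^2) \<Rightarrow> complex) \<Rightarrow> bool" where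
  "holCM_on U g \<longleftrightarrow> open U \<and>
     (\<forall>p\<in>U. \<exists>c d. (g has_derivative (\<lambda>(w, v). c * w + (\<Sum>i\<in>UNIV. d $ i * v $ i))) (at p))"

text \<open>The rings $C\{t\}$, $C\{t,z\}$, $C\{t_2,z\}$ and $C\{t,z]]$.\<close>

definition germ_t :: "(complex^2 \<Rightarrow> complex) \<Rightarrow> bool" where
  "germ_t g \<longleftrightarrow> (\<exists>U. 0 \<in> U \<and> holM_on U g)"

definition germ_tz :: "(complex \<times> (complex^2) \<Rightarrow> complex) \<Rightarrow> bool" where
  "germ_tz g \<longleftrightarrow> (\<exists>U. 0 \<in> U \<and> holCM_on U g)"

(* f t2 z; the ring is the subring of C{t,z} of germs that do not depend on t1 *)
definition germ_t2z :: "(complex \<Rightarrow> complex \<Rightarrow> complex) \<Rightarrow> bool" where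
  "germ_t2z f \<longleftrightarrow> germ_tz (\<lambda>(z, t). f (t $ 2) z)"

(* all coefficients are holomorphic on one common neighbourhood; no convergence in z *)
definition germ_t_formal_z :: "(complex^2 \<Rightarrow> complex fps) \<Rightarrow> bool" where
  "germ_t_formal_z F \<longleftrightarrow> (\<exists>U. 0 \<in> U \<and> (\<forall>n. holM_on U (\<lambda>t. fps_nth (F t) n)))"

definition pd :: "2 \<Rightarrow> (complex^2 \<Rightarrow> complex) \<Rightarrow> complex^2 \<Rightarrow> complex" where
  "pd i g t = deriv (\<lambda>w. g (t + axis i w)) 0"

definition pd_mat :: "2 \<Rightarrow> (complex^2 \<Rightarrow> complex^2^2) \<Rightarrow> complex^2 \<Rightarrow> complex^2^2" where
  "pd_mat i G t = (\<chi> a b. pd i (\<lambda>s. G s $ a $ b) t)"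

definition pd_fps_mat :: "2 \<Rightarrow> (complex^2 \<Rightarrow> complex fps^2^2) \<Rightarrow> complex^2 \<Rightarrow> complex fps^2^2" where
  "pd_fps_mat i F t = (\<chi> a b. Abs_fps (\<lambda>n. pd i (\<lambda>s. fps_nth (F s $ a $ b) n) t))"

text \<open>Throughout, \<open>mat c ** X\<close> is the scalar multiple of the matrix \<open>X\<close> by \<open>c\<close>.\<close>

type_synonym matrix_pair = "2 \<Rightarrow> complex \<times> (complex^2) \<Rightarrow> complex^2^2"

(* the second conjunct is flatness *)
definition T_structure :: "matrix_pair \<Rightarrow> bool" where
  "T_structure A \<longleftrightarrow>
     (\<forall>i a b. germ_tz (\<lambda>p. A i p $ a $ b)) \<and>
     (\<forall>\<^sub>F (z, t) in nhds 0.
        mat z ** pd_mat 1 (\<lambda>s. A 2 (z, s)) t - mat z ** pd_mat 2 (\<lambda>s. A 1 (z, s)) t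
        + (A 1 (z, t) ** A 2 (z, t) - A 2 (z, t) ** A 1 (z, t)) = 0)"

(* C_X = X1 A1(0) + X2 A2(0) at the point t, for a tangent vector X at t *)
definition higgs :: "matrix_pair \<Rightarrow> complex^2 \<Rightarrow> complex^2 \<Rightarrow> complex^2^2" where
  "higgs A t X = (\<Sum>i\<in>UNIV. mat (X $ i) ** A i (0, t))"

definition unfolding_section :: "matrix_pair \<Rightarrow> (complex^2 \<Rightarrow> complex^2) \<Rightarrow> bool" where
  "unfolding_section A \<zeta> \<longleftrightarrow>
     (\<forall>a. germ_t (\<lambda>t. \<zeta> t $ a)) \<and> (\<forall>\<^sub>F t in nhds 0. bij (\<lambda>X. higgs A t X *v \<zeta> t))"

(* the bilinear multiplication on tangent vectors with unit e1 and e2 o e2 = 0 *)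
definition N2_mult :: "complex^2 \<Rightarrow> complex^2 \<Rightarrow> complex^2" where
  "N2_mult X Y = vector [X $ 1 * Y $ 1, X $ 1 * Y $ 2 + X $ 2 * Y $ 1]"

definition N2_unit :: "complex^2" where
  "N2_unit = axis 1 1"

(* The multiplication induced by a (T)-structure does not depend on the choice of the
   section \<zeta>, so asking for one \<zeta> is the same as asking for all. *)
definition T_structure_over_N2 :: "matrix_pair \<Rightarrow> bool" where
  "T_structure_over_N2 A \<longleftrightarrow> T_structure A \<and>
     (\<exists>\<zeta>. unfolding_section A \<zeta> \<and>
        (\<forall>\<^sub>F t in nhds 0.
           (\<forall>X Y. higgs A t (N2_mult X Y) *v \<zeta> t = higgs A t X *v (higgs A t Y *v \<zeta> t)) \<and>
           higgs A t N2_unit *v \<zeta> t = \<zeta> t))"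

definition biholomorphic_germ :: "(complex^2 \<Rightarrow> complex^2) \<Rightarrow> bool" where
  "biholomorphic_germ h \<longleftrightarrow> h 0 = 0 \<and>
     (\<exists>U V g. 0 \<in> U \<and> 0 \<in> V \<and> h ` U = V \<and> g ` V = U \<and>
        (\<forall>t\<in>U. g (h t) = t) \<and> (\<forall>s\<in>V. h (g s) = s) \<and>
        (\<forall>i. holM_on U (\<lambda>t. h t $ i)) \<and> (\<forall>i. holM_on V (\<lambda>s. g s $ i)))"

(* isomorphism T from A' to A covering h *)
definition hol_isomorphism ::
  "matrix_pair \<Rightarrow> matrix_pair \<Rightarrow> (complex^2 \<Rightarrow> complex^2) \<Rightarrow>
   (complex \<times> (complex^2) \<Rightarrow> complex^2^2) \<Rightarrow> bool" where
  "hol_isomorphism A' A h T \<longleftrightarrow>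
     biholomorphic_germ h \<and>
     (\<forall>a b. germ_tz (\<lambda>p. T p $ a $ b)) \<and>
     (\<forall>\<^sub>F t in nhds 0. invertible (T (0, t))) \<and>
     (\<forall>i. \<forall>\<^sub>F (z, t) in nhds 0.
        mat z ** pd_mat i (\<lambda>s. T (z, s)) t
        + (\<Sum>j\<in>UNIV. mat (pd i (\<lambda>s. h s $ j) t) ** A j (z, h t)) ** T (z, t)
        - T (z, t) ** A' i (z, t) = 0)"

definition hol_isomorphic :: "matrix_pair \<Rightarrow> matrix_pair \<Rightarrow> bool" where
  "hol_isomorphic A' A \<longleftrightarrow> (\<exists>h T. hol_isomorphism A' A h T)"

(* expansion in z, i.e. the inclusion of C{t,z} into C{t,z]] *)
definition z_expansion :: "(complex \<times> (complex^2) \<Rightarrow> complex^2^2) \<Rightarrow> complex^2 \<Rightarrow> complex fps^2^2" where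
  "z_expansion G t = (\<chi> a b. fps_expansion (\<lambda>z. G (z, t) $ a $ b) 0)"

(* fps_X plays the role of z *)
definition formal_isomorphism ::
  "matrix_pair \<Rightarrow> matrix_pair \<Rightarrow> (complex^2 \<Rightarrow> complex^2) \<Rightarrow>
   (complex^2 \<Rightarrow> complex fps^2^2) \<Rightarrow> bool" where
  "formal_isomorphism A' A h T \<longleftrightarrow>
     biholomorphic_germ h \<and>
     (\<forall>a b. germ_t_formal_z (\<lambda>t. T t $ a $ b)) \<and>
     (\<forall>\<^sub>F t in nhds 0. invertible (\<chi> a b. fps_nth (T t $ a $ b) 0)) \<and>
     (\<forall>i. \<forall>\<^sub>F t in nhds 0.
        mat fps_X ** pd_fps_mat i T t
        + (\<Sum>j\<in>UNIV. mat (fps_const (pd i (\<lambda>s. h s $ j) t)) ** z_expansion (A j) (h t)) ** T t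
        - T t ** z_expansion (A' i) t = 0)"

definition formally_isomorphic :: "matrix_pair \<Rightarrow> matrix_pair \<Rightarrow> bool" where
  "formally_isomorphic A' A \<longleftrightarrow> (\<exists>h T. formal_isomorphism A' A h T)"

definition C2 :: "complex^2^2" where
  "C2 = vector [vector [0, 0], vector [1, 0]]"

definition E :: "complex^2^2" where
  "E = vector [vector [0, 1], vector [0, 0]]"

definition normal_form :: "(complex \<Rightarrow> complex \<Rightarrow> complex) \<Rightarrow> matrix_pair" where
  "normal_form f i = (\<lambda>(z, t). if i = 1 then mat 1 else C2 + mat (z * f (t $ 2) z) ** E)"

definition associated :: "(complex \<Rightarrow> complex \<Rightarrow> complex) \<Rightarrow> matrix_pair \<Rightarrow> bool" where
  "associated f A \<longleftrightarrow> germ_t2z f \<and> hol_isomorphic A (normal_form f)"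

(* the coefficient f(n), a function of t2, of f = \<Sum>n. f(n) z^n *)
definition zcoeff :: "(complex \<Rightarrow> complex \<Rightarrow> complex) \<Rightarrow> nat \<Rightarrow> complex \<Rightarrow> complex" where
  "zcoeff f n s = fps_nth (fps_expansion (\<lambda>z. f s z) 0) n"

(* subdegree is 0 on the zero series, whereas the order of 0 is \<infinity> *)
definition ord0 :: "(complex \<Rightarrow> complex) \<Rightarrow> enat" where
  "ord0 g = (if fps_expansion g 0 = 0 then \<infinity> else enat (subdegree (fps_expansion g 0)))"

end

(* A holomorphic change of the coordinate t2 by rho with rho' = 1 / a^2, together with the gauge
   transformation ((a, z a'), (0, 1/a)), turns the function g into f with
   f(rho(s), z) = (g(s, z) - z a''(s)/a(s)) a(s)^4. If g(0) = 0, solving the linear equation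
   a'' = g(1) a makes f(1) vanish; if g(0) has order r, solving rho'^2 rho^r = g(0) makes f(0) = t2^r.
   For the invariance, only the z-expansion of a formal isomorphism up to first order matters: between
   two normal forms its leading term is lower triangular, and comparing the upper right entries
   of the terms linear in z shows that f(0) and g(0) agree up to a coordinate change and a unit. *)

theory Submission
  imports Defs
begin

unbundle no Formal_Power_Series.fps_syntax


subsection \<open>Holomorphic functions on \<open>M\<close> and on \<open>C \<times> M\<close>\<close>

text \<open>The gauge transformation is forced by the equation in the direction of
  \<open>t_2\<close>: its lower left entry reads \<open>\<rho>' a = 1/a\<close>, its upper left
  entry demands the correction \<open>z a'\<close>, its lower right entry is then automatic, and its
  upper right entry determines \<open>f\<close>. As transformation laws this says that
  \<open>f(0)\<close> behaves like a quadratic differential, because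
  \<open>a^4 = 1/\<rho>'^2\<close>, while \<open>a''/a\<close> is minus one half of the Schwarzian
  derivative of \<open>\<rho>\<close>, so \<open>f(1)\<close> is corrected like a projective
  connection. The obstacle in the invariance is that convergent and formal isomorphisms live in
  different rings and have to be composed. Both have 1-jets in \<open>z\<close>, and these compose.
  The two normal forms are compared over the common source \<open>A\<close>, by two maps
  \<open>h\<close> and \<open>k\<close> on the same germ, so that only matrices have to be divided.
  The maps depend on two variables; restriction to a coordinate axis along which their second
  components have nonzero derivative turns the comparison of orders into one about power series in
  one variable.\<close>

definition cdiff_M :: "(complex^2 \<Rightarrow> complex) \<Rightarrow> complex^2 \<Rightarrow> bool" where
  "cdiff_M g t \<longleftrightarrow> (\<exists>d. (g has_derivative (\<lambda>v. \<Sum>i\<in>UNIV. d $ i * v $ i)) (at t))"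

definition cdiff_CM :: "(complex \<times> (complex^2) \<Rightarrow> complex) \<Rightarrow> complex \<times> (complex^2) \<Rightarrow> bool" where
  "cdiff_CM g p \<longleftrightarrow>
     (\<exists>c d. (g has_derivative (\<lambda>(w, v). c * w + (\<Sum>i\<in>UNIV. d $ i * v $ i))) (at p))"

lemma holM_on_iff: "holM_on U g \<longleftrightarrow> open U \<and> (\<forall>t\<in>U. cdiff_M g t)"
  by (simp add: holM_on_def cdiff_M_def)

text \<open>Openness of the set is part of \<open>holCM_on\<close>, so a germ is the same as an
  eventual pointwise property. Common neighbourhoods thus never have to be named: they come from
  conjunctions of eventual statements.\<close>

lemma germ_tz_iff: "germ_tz g \<longleftrightarrow> (\<forall>\<^sub>F p in nhds 0. cdiff_CM g p)"
  unfolding germ_tz_def eventually_nhds holCM_on_def cdiff_CM_def by auto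

lemma has_derivative_vecI:
  fixes h :: "'a::real_normed_vector \<Rightarrow> complex^2"
  assumes "\<And>j. ((\<lambda>x. h x $ j) has_derivative (\<lambda>v. D v $ j)) (at x)"
  shows "(h has_derivative D) (at x)"
proof (subst has_derivative_componentwise_within, rule ballI)
  fix b :: "complex^2" assume "b \<in> Basis"
  then obtain j c where b: "b = axis j c" by (auto simp: Basis_vec_def)
  show "((\<lambda>x. h x \<bullet> b) has_derivative (\<lambda>x. D x \<bullet> b)) (at x)"
    unfolding b inner_axis by (intro has_derivative_inner_left assms)
qed

lemma cdiff_M_const [intro, simp]: "cdiff_M (\<lambda>_. c) t"
  unfolding cdiff_M_def by (rule exI[of _ 0]) simp

lemma cdiff_M_nth [intro, simp]: "cdiff_M (\<lambda>s. s $ j) t"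
  unfolding cdiff_M_def
  by (rule exI[of _ "axis j 1"])
    (auto simp: axis_def if_distrib if_distribR
       intro: bounded_linear_imp_has_derivative bounded_linear_vec_nth cong: if_cong)

lemma cdiff_M_add:
  assumes "cdiff_M f t" "cdiff_M g t"
  shows "cdiff_M (\<lambda>s. f s + g s) t"
proof -
  obtain d e where "(f has_derivative (\<lambda>v. \<Sum>i\<in>UNIV. d $ i * v $ i)) (at t)"
    "(g has_derivative (\<lambda>v. \<Sum>i\<in>UNIV. e $ i * v $ i)) (at t)"
    using assms by (auto simp: cdiff_M_def)
  from has_derivative_add[OF this] show ?thesis
    unfolding cdiff_M_def by (intro exI[of _ "d + e"]) (simp add: sum_2 algebra_simps)
qed

lemma cdiff_M_mult:
  assumes "cdiff_M f t" "cdiff_M g t"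
  shows "cdiff_M (\<lambda>s. f s * g s) t"
proof -
  obtain d e where "(f has_derivative (\<lambda>v. \<Sum>i\<in>UNIV. d $ i * v $ i)) (at t)"
    "(g has_derivative (\<lambda>v. \<Sum>i\<in>UNIV. e $ i * v $ i)) (at t)"
    using assms by (auto simp: cdiff_M_def)
  from has_derivative_mult[OF this] show ?thesis
    unfolding cdiff_M_def
    by (intro exI[of _ "\<chi> i. f t * e $ i + d $ i * g t"]) (simp add: sum_2 algebra_simps)
qed

lemma cdiff_M_compose_field:
  assumes "cdiff_M u t" "F field_differentiable (at (u t))"
  shows "cdiff_M (\<lambda>s. F (u s)) t"
proof -
  obtain d where d: "(u has_derivative (\<lambda>v. \<Sum>i\<in>UNIV. d $ i * v $ i)) (at t)"
    using assms by (auto simp: cdiff_M_def)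
  obtain c where "(F has_derivative (\<lambda>v. c * v)) (at (u t))"
    using assms by (auto simp: field_differentiable_def has_field_derivative_def)
  from has_derivative_compose[OF d this] show ?thesis
    unfolding cdiff_M_def by (intro exI[of _ "\<chi> i. c * d $ i"]) (simp add: sum_2 algebra_simps)
qed

lemma cdiff_M_diff: 
  assumes "cdiff_M f t" "cdiff_M g t"
  shows "cdiff_M (\<lambda>s. f s - g s) t"
  using cdiff_M_add[OF assms(1) cdiff_M_mult[OF cdiff_M_const assms(2), of "-1"]] by simp

lemma cdiff_M_divide:
  assumes "cdiff_M f t" "cdiff_M g t" "g t \<noteq> 0"
  shows "cdiff_M (\<lambda>s. f s / g s) t"
  using cdiff_M_mult[OF assms(1) cdiff_M_compose_field[OF assms(2), of inverse]] assms(3)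
    field_differentiable_inverse[OF field_differentiable_ident, of "g t"]
  by (simp add: divide_inverse)

lemma cdiff_M_compose:
  assumes "\<And>j. cdiff_M (\<lambda>s. h s $ j) t" "cdiff_M g (h t)"
  shows "cdiff_M (\<lambda>s. g (h s)) t"
proof -
  from assms(1) have "\<forall>j. \<exists>d. ((\<lambda>s. h s $ j) has_derivative (\<lambda>v. \<Sum>i\<in>UNIV. d $ i * v $ i)) (at t)"
    unfolding cdiff_M_def by blast
  from choice[OF this] obtain D where
    D: "\<And>j. ((\<lambda>s. h s $ j) has_derivative (\<lambda>v. \<Sum>i\<in>UNIV. D j $ i * v $ i)) (at t)"
    by blast
  have D': "(h has_derivative (\<lambda>v. \<chi> j. \<Sum>i\<in>UNIV. D j $ i * v $ i)) (at t)"
    by (rule has_derivative_vecI) (simp add: D)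
  from assms(2) obtain e where
    "(g has_derivative (\<lambda>v. \<Sum>i\<in>UNIV. e $ i * v $ i)) (at (h t))"
    unfolding cdiff_M_def by blast
  from has_derivative_compose[OF D' this] show ?thesis
    unfolding cdiff_M_def
    by (intro exI[of _ "\<chi> i. \<Sum>j\<in>UNIV. e $ j * D j $ i"]) (simp add: sum_2 algebra_simps)
qed

lemma cdiff_M_imp_isCont: "cdiff_M g t \<Longrightarrow> isCont g t"
  unfolding cdiff_M_def using has_derivative_continuous by blast

lemma isCont_vecI:
  fixes h :: "'a::t2_space \<Rightarrow> complex^2"
  assumes "\<And>j. isCont (\<lambda>s. h s $ j) t"
  shows "isCont h t"
  using assms unfolding isCont_def by (intro vec_tendstoI) auto


subsection \<open>Partial derivatives\<close>

lemma add_axis_0 [simp]: "(t :: complex^2) + axis i 0 = t"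
  by (simp add: vec_eq_iff axis_def)

lemma has_derivative_axis: "((\<lambda>w. (t :: complex^2) + axis i w) has_derivative axis i) (at (z::complex))"
proof (rule has_derivative_vecI)
  show "((\<lambda>w. (t + axis i w) $ j) has_derivative (\<lambda>v. axis i v $ j)) (at z)" for j
    by (cases "j = i") (auto simp: axis_def intro!: derivative_eq_intros)
qed

lemma has_field_derivative_along_axis:
  fixes g :: "complex^2 \<Rightarrow> complex"
  assumes "(g has_derivative (\<lambda>v. \<Sum>i\<in>UNIV. d $ i * v $ i)) (at t)"
  shows "((\<lambda>w. g (t + axis i w)) has_field_derivative d $ i) (at (0::complex))"
proof -
  have "(g has_derivative (\<lambda>v. \<Sum>i\<in>UNIV. d $ i * v $ i)) (at (t + axis i 0))"
    using assms by simp
  from has_derivative_compose[OF has_derivative_axis this] show ?thesis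
    by (simp add: has_field_derivative_def axis_def if_distrib cong: if_cong)
qed

lemma pd_eqI:
  assumes "(g has_derivative (\<lambda>v. \<Sum>i\<in>UNIV. d $ i * v $ i)) (at t)"
  shows "pd i g t = d $ i"
  unfolding pd_def using has_field_derivative_along_axis[OF assms] by (rule DERIV_imp_deriv)

lemma cdiff_M_has_derivative:
  assumes "cdiff_M g t"
  shows "(g has_derivative (\<lambda>v. \<Sum>i\<in>UNIV. pd i g t * v $ i)) (at t)"
  using assms pd_eqI unfolding cdiff_M_def by fastforce

lemma cdiff_M_field_derivative:
  assumes "cdiff_M g t"
  shows "((\<lambda>w. g (t + axis i w)) has_field_derivative pd i g t) (at 0)"
  using has_field_derivative_along_axis[of g "\<chi> i. pd i g t"] cdiff_M_has_derivative[OF assms]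
  by simp

lemma pd_const [simp]: "pd i (\<lambda>_. c) t = 0"
  by (simp add: pd_def)

lemma pd_nth: "pd i (\<lambda>s. s $ j) t = (if i = j then 1 else 0)"
proof -
  have "((\<lambda>s. s $ j) has_derivative (\<lambda>v. \<Sum>i\<in>UNIV. axis j 1 $ i * v $ i)) (at t)"
    by (auto simp: axis_def if_distrib if_distribR
        intro: bounded_linear_imp_has_derivative bounded_linear_vec_nth cong: if_cong)
  from pd_eqI[OF this] show ?thesis by (auto simp: axis_def)
qed

lemma filterlim_axis: "filterlim (\<lambda>w. t + axis i w) (nhds t) (nhds (0 :: complex))"
  for t :: "complex^2"
  using has_derivative_continuous[OF has_derivative_axis[of t i 0]]
    tendsto_at_iff_tendsto_nhds[of "\<lambda>w. t + axis i w" 0]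
  by (simp add: isCont_def)

lemma pd_cong_ev:
  assumes "\<forall>\<^sub>F s in nhds t. f s = g s"
  shows "pd i f t = pd i g t"
  unfolding pd_def
proof (rule deriv_cong_ev)
  show "\<forall>\<^sub>F w in nhds 0. f (t + axis i w) = g (t + axis i w)"
    by (rule eventually_compose_filterlim[OF assms filterlim_axis])
qed simp

lemma pd_add:
  assumes "cdiff_M f t" "cdiff_M g t"
  shows "pd i (\<lambda>s. f s + g s) t = pd i f t + pd i g t"
  unfolding pd_def[of i "\<lambda>s. f s + g s"]
  by (rule DERIV_imp_deriv)
    (auto intro!: derivative_eq_intros cdiff_M_field_derivative assms)

lemma pd_mult:
  assumes "cdiff_M f t" "cdiff_M g t"
  shows "pd i (\<lambda>s. f s * g s) t = pd i f t * g t + f t * pd i g t"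
proof -
  show ?thesis
    unfolding pd_def[of i "\<lambda>s. f s * g s"]
    by (rule DERIV_imp_deriv)
      (auto intro!: derivative_eq_intros cdiff_M_field_derivative assms)
qed

lemma pd_compose_field:
  assumes "cdiff_M u t" "(F has_field_derivative F') (at (u t))"
  shows "pd i (\<lambda>s. F (u s)) t = F' * pd i u t"
proof -
  show ?thesis
    unfolding pd_def[of i "\<lambda>s. F (u s)"]
    by (rule DERIV_imp_deriv, rule DERIV_chain2[OF _ cdiff_M_field_derivative[OF assms(1)]])
      (simp add: assms(2))
qed

lemma pd_compose:
  assumes "\<And>j. cdiff_M (\<lambda>s. h s $ j) t" "cdiff_M g (h t)"
  shows "pd i (\<lambda>s. g (h s)) t = (\<Sum>j\<in>UNIV. pd i (\<lambda>s. h s $ j) t * pd j g (h t))"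
proof -
  have D': "(h has_derivative (\<lambda>v. \<chi> j. \<Sum>i\<in>UNIV. pd i (\<lambda>s. h s $ j) t * v $ i)) (at t)"
    by (rule has_derivative_vecI) (simp add: cdiff_M_has_derivative[OF assms(1)])
  have "((\<lambda>s. g (h s)) has_derivative
      (\<lambda>v. \<Sum>i\<in>UNIV. (\<chi> i. \<Sum>j\<in>UNIV. pd i (\<lambda>s. h s $ j) t * pd j g (h t)) $ i * v $ i)) (at t)"
    using has_derivative_compose[OF D' cdiff_M_has_derivative[OF assms(2)]]
    by (simp add: sum_2 algebra_simps)
  from pd_eqI[OF this] show ?thesis by simp
qed

lemma pd_mat_mult:
  assumes "\<And>a b. cdiff_M (\<lambda>s. X s $ a $ b) t" "\<And>a b. cdiff_M (\<lambda>s. Y s $ a $ b) t"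
  shows "pd_mat i (\<lambda>s. X s ** Y s) t = pd_mat i X t ** Y t + X t ** pd_mat i Y t"
  by (simp add: pd_mat_def matrix_matrix_mult_def vec_eq_iff sum_2 pd_add pd_mult
      cdiff_M_mult assms)

lemma pd_mat_compose:
  assumes "\<And>j. cdiff_M (\<lambda>s. h s $ j) t" "\<And>a b. cdiff_M (\<lambda>s. X s $ a $ b) (h t)"
  shows "pd_mat i (\<lambda>s. X (h s)) t = (\<Sum>j\<in>UNIV. mat (pd i (\<lambda>s. h s $ j) t) ** pd_mat j X (h t))"
proof -
  have "pd i (\<lambda>s. X (h s) $ a $ b) t = (\<Sum>j\<in>UNIV. pd i (\<lambda>s. h s $ j) t * pd j (\<lambda>s. X s $ a $ b) (h t))"
    for a b
    using pd_compose[OF assms(1), of "\<lambda>s. X s $ a $ b"] assms(2) by blast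
  then show ?thesis
    by (simp add: pd_mat_def matrix_matrix_mult_def mat_def vec_eq_iff sum_2 forall_2)
qed

lemma pd_mat_cong_ev:
  assumes "\<forall>\<^sub>F s in nhds t. X s = Y s"
  shows "pd_mat i X t = pd_mat i Y t"
  unfolding pd_mat_def by (simp add: vec_eq_iff, intro allI pd_cong_ev eventually_mono[OF assms]) simp

lemma cdiff_M_matrix_mult:
  fixes X Y :: "complex^2 \<Rightarrow> complex^2^2"
  assumes "\<And>a b. cdiff_M (\<lambda>s. X s $ a $ b) t" "\<And>a b. cdiff_M (\<lambda>s. Y s $ a $ b) t"
  shows "cdiff_M (\<lambda>s. (X s ** Y s) $ a $ b) t"
  unfolding matrix_matrix_mult_def by (simp add: sum_2 cdiff_M_add cdiff_M_mult assms)


subsection \<open>Holomorphic functions on \<open>C \<times> M\<close>\<close>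

lemma cdiff_CM_fst [intro, simp]: "cdiff_CM fst p"
  unfolding cdiff_CM_def
  by (intro exI[of _ 1] exI[of _ 0])
    (auto simp: case_prod_unfold intro!: bounded_linear_imp_has_derivative bounded_linear_fst)

lemma cdiff_CM_snd:
  assumes "cdiff_M g (snd p)"
  shows "cdiff_CM (\<lambda>p. g (snd p)) p"
proof -
  obtain d where "(g has_derivative (\<lambda>v. \<Sum>i\<in>UNIV. d $ i * v $ i)) (at (snd p))"
    using assms by (auto simp: cdiff_M_def)
  from has_derivative_compose[OF bounded_linear_imp_has_derivative[OF bounded_linear_snd] this]
  show ?thesis
    unfolding cdiff_CM_def by (intro exI[of _ 0] exI[of _ d]) (simp add: case_prod_unfold)
qed

lemma cdiff_CM_add:
  assumes "cdiff_CM f p" "cdiff_CM g p"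
  shows "cdiff_CM (\<lambda>p. f p + g p) p"
proof -
  obtain b c d e where
    "(f has_derivative (\<lambda>(w, v). b * w + (\<Sum>i\<in>UNIV. d $ i * v $ i))) (at p)"
    "(g has_derivative (\<lambda>(w, v). c * w + (\<Sum>i\<in>UNIV. e $ i * v $ i))) (at p)"
    using assms by (auto simp: cdiff_CM_def)
  from has_derivative_add[OF this] show ?thesis
    unfolding cdiff_CM_def
    by (intro exI[of _ "b + c"] exI[of _ "d + e"]) (simp add: sum_2 algebra_simps case_prod_unfold)
qed

lemma cdiff_CM_mult:
  assumes "cdiff_CM f p" "cdiff_CM g p"
  shows "cdiff_CM (\<lambda>p. f p * g p) p"
proof -
  obtain b c d e where
    "(f has_derivative (\<lambda>(w, v). b * w + (\<Sum>i\<in>UNIV. d $ i * v $ i))) (at p)"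
    "(g has_derivative (\<lambda>(w, v). c * w + (\<Sum>i\<in>UNIV. e $ i * v $ i))) (at p)"
    using assms by (auto simp: cdiff_CM_def)
  from has_derivative_mult[OF this] show ?thesis
    unfolding cdiff_CM_def
    by (intro exI[of _ "f p * c + b * g p"] exI[of _ "\<chi> i. f p * e $ i + d $ i * g p"])
      (simp add: sum_2 algebra_simps case_prod_unfold)
qed

lemma cdiff_CM_compose:
  assumes "\<And>j. cdiff_M (\<lambda>s. h s $ j) (snd p)" "cdiff_CM g (fst p, h (snd p))"
  shows "cdiff_CM (\<lambda>p. g (fst p, h (snd p))) p"
proof -
  have D: "(h has_derivative (\<lambda>v. \<chi> j. \<Sum>i\<in>UNIV. pd i (\<lambda>s. h s $ j) (snd p) * v $ i)) (at (snd p))"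
    by (rule has_derivative_vecI) (simp add: cdiff_M_has_derivative[OF assms(1)])
  have D': "((\<lambda>p. (fst p, h (snd p))) has_derivative
      (\<lambda>q. (fst q, \<chi> j. \<Sum>i\<in>UNIV. pd i (\<lambda>s. h s $ j) (snd p) * snd q $ i))) (at p)"
    by (intro has_derivative_Pair bounded_linear_imp_has_derivative[OF bounded_linear_fst]
        has_derivative_compose[where g = h and f = snd, OF _ D]
        bounded_linear_imp_has_derivative[OF bounded_linear_snd])
  obtain c d where "(g has_derivative (\<lambda>(w, v). c * w + (\<Sum>i\<in>UNIV. d $ i * v $ i)))
      (at (fst p, h (snd p)))"
    using assms(2) by (auto simp: cdiff_CM_def)
  from has_derivative_compose[OF D' this] show ?thesis
    unfolding cdiff_CM_def
    by (intro exI[of _ c] exI[of _ "\<chi> i. \<Sum>j\<in>UNIV. d $ j * pd i (\<lambda>s. h s $ j) (snd p)"])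
      (simp add: sum_2 algebra_simps case_prod_unfold)
qed

lemma cdiff_CM_slice:
  assumes "cdiff_CM g (z, t)"
  shows "cdiff_M (\<lambda>s. g (z, s)) t" "(\<lambda>w. g (w, t)) field_differentiable (at z)"
proof -
  obtain c d where cd: "(g has_derivative (\<lambda>(w, v). c * w + (\<Sum>i\<in>UNIV. d $ i * v $ i))) (at (z, t))"
    using assms by (auto simp: cdiff_CM_def)
  have "((\<lambda>s. (z, s)) has_derivative (\<lambda>v. (0, v))) (at t)"
    by (auto intro!: derivative_eq_intros)
  from has_derivative_compose[OF this cd] show "cdiff_M (\<lambda>s. g (z, s)) t"
    unfolding cdiff_M_def by auto
  have "((\<lambda>w. (w, t)) has_derivative (\<lambda>v. (v, 0))) (at z)"
    by (auto intro!: derivative_eq_intros)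
  from has_derivative_compose[OF this cd] show "(\<lambda>w. g (w, t)) field_differentiable (at z)"
    unfolding field_differentiable_def has_field_derivative_def by auto
qed

lemma cdiff_CM_imp_isCont: "cdiff_CM g p \<Longrightarrow> isCont g p"
  unfolding cdiff_CM_def using has_derivative_continuous by blast

text \<open>A neighbourhood of the origin contains a product neighbourhood. This form allows an
  identity to be differentiated in \<open>z\<close> while \<open>t\<close> is held fixed.\<close>

lemma eventually_nhds_0_pair:
  assumes "\<forall>\<^sub>F p in nhds (0 :: 'a::{topological_space,zero} \<times> 'b::{topological_space,zero}). P p"
  shows "\<forall>\<^sub>F t in nhds 0. \<forall>\<^sub>F z in nhds 0. P (z, t)"
proof -
  obtain Q R where "eventually Q (nhds (0 :: 'a))" and R: "eventually R (nhds (0 :: 'b))"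
    and QR: "\<And>z t. Q z \<Longrightarrow> R t \<Longrightarrow> P (z, t)"
    using assms unfolding zero_prod_def nhds_prod eventually_prod_filter by blast
  from R show ?thesis
    by eventually_elim (use \<open>eventually Q (nhds 0)\<close> QR in \<open>auto elim: eventually_mono\<close>)
qed


subsection \<open>Analytic dependence of derivatives on parameters\<close>

text \<open>The derivative is a locally uniform limit of difference quotients in \<open>v\<close>,
  and each quotient is holomorphic in \<open>s\<close>. Uniformity comes from Taylor's formula of
  degree one, whose remainder is controlled by a Cauchy estimate for the second derivative.\<close>

lemma holomorphic_on_deriv_second:
  fixes \<phi> :: "complex \<Rightarrow> complex \<Rightarrow> complex"
  assumes "open U" "0 < r"
    and hol2: "\<And>s. s \<in> U \<Longrightarrow> \<phi> s holomorphic_on ball w r"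
    and hol1: "\<And>v. v \<in> ball w r \<Longrightarrow> (\<lambda>s. \<phi> s v) holomorphic_on U"
    and cont: "continuous_on (U \<times> ball w r) (\<lambda>(s, v). \<phi> s v)"
  shows "(\<lambda>s. deriv (\<phi> s) w) holomorphic_on U"
proof (rule holomorphic_uniform_sequence[OF \<open>open U\<close>])
  \<comment> \<open>Steps of at most \<open>r / 4\<close> keep the discs of radius
    \<open>r / 4\<close> about all points concerned inside \<open>cball w (r / 2)\<close>, where
    \<open>\<phi>\<close> is bounded by compactness.\<close>
  define e where "e n = r / 4 / real (Suc n)" for n
  define f where "f n s = (\<phi> s (w + of_real (e n)) - \<phi> s w) / of_real (e n)" for n s
  have e: "0 < e n" "e n \<le> r / 4" for n
    using \<open>0 < r\<close> by (auto simp: e_def field_simps)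
  have e_lim: "e \<longlonglongrightarrow> 0"
    unfolding e_def by (intro LIMSEQ_Suc lim_const_over_n)
  show "f n holomorphic_on U" for n
    unfolding f_def using e[of n] \<open>0 < r\<close>
    by (intro holomorphic_intros hol1) (auto simp: dist_norm)
  fix x assume "x \<in> U"
  obtain d where d: "d > 0" "cball x d \<subseteq> U"
    using \<open>open U\<close> \<open>x \<in> U\<close> open_contains_cball by blast
  have "compact ((\<lambda>(s, v). \<phi> s v) ` (cball x d \<times> cball w (r / 2)))"
    using d \<open>0 < r\<close>
    by (intro compact_continuous_image compact_Times continuous_on_subset[OF cont]) auto
  then obtain M where M: "\<And>s v. s \<in> cball x d \<Longrightarrow> v \<in> cball w (r / 2) \<Longrightarrow> norm (\<phi> s v) \<le> M"
    using that by (force dest!: compact_imp_bounded simp: bounded_iff)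
  \<comment> \<open>The Cauchy bound for the second derivative on discs of radius
    \<open>r / 4\<close>; it does not depend on \<open>s\<close>.\<close>
  define B where "B = fact 2 * M / (r / 4)\<^sup>2"
  have bound: "norm (f n s - deriv (\<phi> s) w) \<le> B * e n" if s: "s \<in> cball x d" for n s
  proof -
    have hol: "\<phi> s holomorphic_on ball w r" using s d hol2 by auto
    have B: "norm ((deriv ^^ 2) (\<phi> s) v) \<le> B" if v: "v \<in> cball w (r / 4)" for v
      unfolding B_def
    proof (rule Cauchy_inequality)
      have sub: "u \<in> cball w (r / 2)" if "u \<in> cball v (r / 4)" for u
        using dist_triangle[of w u v] that v by simp
      then have sub': "cball v (r / 4) \<subseteq> ball w r"
        using \<open>0 < r\<close> by fastforce
      show "\<phi> s holomorphic_on ball v (r / 4)"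
        by (rule holomorphic_on_subset[OF hol]) (use sub' ball_subset_cball in blast)
      show "continuous_on (cball v (r / 4)) (\<phi> s)"
        by (rule continuous_on_subset[OF holomorphic_on_imp_continuous_on[OF hol] sub'])
      show "norm (\<phi> s u) \<le> M" if "norm (v - u) = r / 4" for u
        using sub[of u] that by (intro M s) (simp add: dist_norm)
    qed (use \<open>0 < r\<close> in simp)
    have "norm (\<phi> s (w + of_real (e n)) -
        (\<Sum>i\<le>1. (deriv ^^ i) (\<phi> s) w * (w + of_real (e n) - w) ^ i / fact i))
      \<le> B * norm (w + of_real (e n) - w) ^ Suc 1 / fact 1"
    proof (rule field_Taylor[of "cball w (r / 4)" 1 "\<lambda>i. (deriv ^^ i) (\<phi> s)", simplified funpow_0])
      fix i v assume "v \<in> cball w (r / 4)"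
      then have "v \<in> ball w r" using \<open>0 < r\<close> by simp
      have "(deriv ^^ i) (\<phi> s) holomorphic_on ball w r"
        by (intro holomorphic_higher_deriv hol) simp
      from holomorphic_derivI[OF this _ \<open>v \<in> ball w r\<close>]
      show "((deriv ^^ i) (\<phi> s) has_field_derivative (deriv ^^ Suc i) (\<phi> s) v)
          (at v within cball w (r / 4))"
        by simp
    qed (use B e[of n] \<open>0 < r\<close> in \<open>auto simp: dist_norm numeral_2_eq_2\<close>)
    then have taylor: "norm (\<phi> s (w + of_real (e n)) - (\<phi> s w + deriv (\<phi> s) w * of_real (e n)))
        \<le> B * (e n)\<^sup>2"
      using e(1)[of n] by (simp add: power2_eq_square)
    have "f n s - deriv (\<phi> s) w =
        (\<phi> s (w + of_real (e n)) - (\<phi> s w + deriv (\<phi> s) w * of_real (e n))) / of_real (e n)"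
      using e(1)[of n] by (simp add: f_def field_simps)
    also have "norm \<dots> \<le> B * (e n)\<^sup>2 / e n"
      using taylor e(1)[of n] by (simp add: norm_divide divide_right_mono)
    finally show ?thesis using e(1)[of n] by (simp add: power2_eq_square)
  qed
  have "uniform_limit (cball x d) f (\<lambda>s. deriv (\<phi> s) w) sequentially"
  proof (rule uniform_limitI)
    fix \<epsilon> :: real assume "\<epsilon> > 0"
    have "(\<lambda>n. B * e n) \<longlonglongrightarrow> B * 0" by (intro tendsto_intros e_lim)
    then have "\<forall>\<^sub>F n in sequentially. B * e n < \<epsilon>"
      using \<open>\<epsilon> > 0\<close> by (auto dest: order_tendstoD(2))
    then show "\<forall>\<^sub>F n in sequentially. \<forall>s\<in>cball x d. dist (f n s) (deriv (\<phi> s) w) < \<epsilon>"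
      by eventually_elim (auto simp: dist_norm intro: le_less_trans bound)
  qed
  then show "\<exists>d>0. cball x d \<subseteq> U \<and> uniform_limit (cball x d) f (\<lambda>s. deriv (\<phi> s) w) sequentially"
    using d by blast
qed

text \<open>The local form, to be applied with either of the two variables \<open>z\<close> and an
  axis parameter in the role of the one that is differentiated.\<close>

lemma analytic_deriv_second:
  fixes \<phi> :: "complex \<Rightarrow> complex \<Rightarrow> complex"
  assumes "\<forall>\<^sub>F p in nhds (x, w). isCont (\<lambda>(s, v). \<phi> s v) p \<and>
     \<phi> (fst p) field_differentiable (at (snd p)) \<and>
     (\<lambda>s. \<phi> s (snd p)) field_differentiable (at (fst p))"
  shows "(\<lambda>s. deriv (\<phi> s) w) analytic_on {x}"
proof -
  obtain S where S: "open S" "(x, w) \<in> S"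
    "\<And>p. p \<in> S \<Longrightarrow> isCont (\<lambda>(s, v). \<phi> s v) p"
    "\<And>s v. (s, v) \<in> S \<Longrightarrow> \<phi> s field_differentiable (at v)"
    "\<And>s v. (s, v) \<in> S \<Longrightarrow> (\<lambda>s. \<phi> s v) field_differentiable (at s)"
    using assms unfolding eventually_nhds by (metis fst_conv snd_conv)
  obtain U V where UV: "open U" "open V" "x \<in> U" "w \<in> V" "U \<times> V \<subseteq> S"
    using open_prod_elim[OF S(1,2)] by (metis mem_Sigma_iff)
  obtain r where r: "r > 0" "ball w r \<subseteq> V"
    using UV open_contains_ball by blast
  have sub: "U \<times> ball w r \<subseteq> S" using UV r by auto
  have "(\<lambda>s. deriv (\<phi> s) w) holomorphic_on U"
  proof (rule holomorphic_on_deriv_second[OF UV(1) r(1)])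
    show "\<phi> s holomorphic_on ball w r" if "s \<in> U" for s
      unfolding holomorphic_on_def using S(4) sub that by (blast intro: field_differentiable_at_within)
    show "(\<lambda>s. \<phi> s v) holomorphic_on U" if "v \<in> ball w r" for v
      unfolding holomorphic_on_def using S(5) sub that by (blast intro: field_differentiable_at_within)
    show "continuous_on (U \<times> ball w r) (\<lambda>(s, v). \<phi> s v)"
      using S(3) sub by (intro continuous_at_imp_continuous_on) blast
  qed
  then show ?thesis using UV(1,3) by (auto simp: analytic_at)
qed

lemma analytic_eventually_nonzero:
  assumes "u analytic_on {0 :: complex}" "u 0 \<noteq> 0"
  shows "\<forall>\<^sub>F s in nhds 0. u s \<noteq> 0"
  using analytic_at_imp_isCont[OF assms(1)] tendsto_at_iff_tendsto_nhds[of u 0] assms(2)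
  by (intro tendsto_imp_eventually_ne[of u "u 0"]) (simp_all add: isCont_def)


subsection \<open>Composition of isomorphisms\<close>

lemma eventually_nhds_0_snd:
  "\<forall>\<^sub>F t in nhds (0 :: 'b::{topological_space,zero}). P t \<Longrightarrow>
     \<forall>\<^sub>F p in nhds (0 :: 'a::{topological_space,zero} \<times> 'b). P (snd p)"
  unfolding zero_prod_def nhds_prod by (rule eventually_compose_filterlim[OF _ filterlim_snd])

lemma filterlim_nhds_0_M:
  fixes h :: "'a::t2_space \<Rightarrow> complex^2"
  assumes "isCont h x" "h x = y"
  shows "filterlim h (nhds y) (nhds x)"
  using assms tendsto_at_iff_tendsto_nhds[of h x] by (simp add: isCont_def)

lemma eventually_pair_compose:
  fixes h :: "complex^2 \<Rightarrow> complex^2"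
  assumes "\<forall>\<^sub>F p in nhds (0 :: complex \<times> (complex^2)). P p" "filterlim h (nhds 0) (nhds 0)"
  shows "\<forall>\<^sub>F p in nhds 0. P (fst p, h (snd p))"
proof -
  have "filterlim (\<lambda>p. (fst p, h (snd p))) (nhds 0 \<times>\<^sub>F nhds 0) (nhds 0 \<times>\<^sub>F nhds 0)"
    by (intro filterlim_Pair filterlim_fst filterlim_compose[OF assms(2) filterlim_snd])
  with assms(1) show ?thesis
    unfolding zero_prod_def nhds_prod by (rule eventually_compose_filterlim)
qed

lemma biholomorphic_germ_cdiff:
  assumes "biholomorphic_germ h"
  shows "\<forall>\<^sub>F t in nhds 0. \<forall>j. cdiff_M (\<lambda>s. h s $ j) t"
  using assms unfolding biholomorphic_germ_def holM_on_iff eventually_nhds by metis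

lemma biholomorphic_germ_filterlim:
  assumes "biholomorphic_germ h"
  shows "filterlim h (nhds 0) (nhds 0)"
proof (rule filterlim_nhds_0_M)
  show "isCont h 0"
    using eventually_nhds_x_imp_x[OF biholomorphic_germ_cdiff[OF assms]]
    by (intro isCont_vecI cdiff_M_imp_isCont) auto
  show "h 0 = 0" using assms by (simp add: biholomorphic_germ_def)
qed

lemma biholomorphic_germ_compose:
  assumes "biholomorphic_germ h" "biholomorphic_germ k"
  shows "biholomorphic_germ (\<lambda>t. k (h t))"
proof -
  obtain U V g where h: "h 0 = 0" "0 \<in> U" "0 \<in> V" "h ` U = V" "g ` V = U"
    "\<And>t. t \<in> U \<Longrightarrow> g (h t) = t" "\<And>s. s \<in> V \<Longrightarrow> h (g s) = s" "open U" "open V"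
    "\<And>t i. t \<in> U \<Longrightarrow> cdiff_M (\<lambda>t. h t $ i) t" "\<And>s i. s \<in> V \<Longrightarrow> cdiff_M (\<lambda>s. g s $ i) s"
    using assms(1) unfolding biholomorphic_germ_def holM_on_iff by metis
  obtain U' V' g' where k: "k 0 = 0" "0 \<in> U'" "0 \<in> V'" "k ` U' = V'" "g' ` V' = U'"
    "\<And>t. t \<in> U' \<Longrightarrow> g' (k t) = t" "\<And>s. s \<in> V' \<Longrightarrow> k (g' s) = s" "open U'" "open V'"
    "\<And>t i. t \<in> U' \<Longrightarrow> cdiff_M (\<lambda>t. k t $ i) t" "\<And>s i. s \<in> V' \<Longrightarrow> cdiff_M (\<lambda>s. g' s $ i) s"
    using assms(2) unfolding biholomorphic_germ_def holM_on_iff by metis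
  have cont: "continuous_on U h" "continuous_on V' g'"
    using h(10) k(11) by (auto intro!: continuous_at_imp_continuous_on isCont_vecI cdiff_M_imp_isCont)
  \<comment> \<open>The definition of a biholomorphic germ asks for exact images, so the domain and
    the range of the composite are both cut down, each by a preimage, until the two composites are
    mutually inverse bijections.\<close>
  define W where "W = U \<inter> h -` U'"
  define W' where "W' = V' \<inter> g' -` V"
  have mem: "\<And>t. t \<in> U \<Longrightarrow> h t \<in> V" "\<And>s. s \<in> V \<Longrightarrow> g s \<in> U"
    "\<And>t. t \<in> U' \<Longrightarrow> k t \<in> V'" "\<And>s. s \<in> V' \<Longrightarrow> g' s \<in> U'"
    using h(4,5) k(4,5) by blast+
  have "open W" "open W'"
    unfolding W_def W'_def using cont h k by (auto intro: continuous_open_preimage)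
  moreover have "0 \<in> W" "0 \<in> W'"
    using h(1-3) k(1-3) k(6)[OF k(2)] by (simp_all add: W_def W'_def)
  moreover have kh: "k (h t) \<in> W'" if "t \<in> W" for t using that mem by (auto simp: W_def W'_def k(6))
  moreover have gg: "g (g' s) \<in> W" if "s \<in> W'" for s using that mem by (auto simp: W_def W'_def h(7))
  moreover have 1: "g (g' (k (h t))) = t" if "t \<in> W" for t using that h k by (simp add: W_def)
  moreover have 2: "k (h (g (g' t))) = t" if "t \<in> W'" for t using that h k by (simp add: W'_def)
  moreover have "(\<lambda>t. k (h t)) ` W = W'"
  proof (intro equalityI image_subsetI subsetI)
    show "k (h t) \<in> W'" if "t \<in> W" for t using kh[OF that] .
    show "s \<in> (\<lambda>t. k (h t)) ` W" if "s \<in> W'" for s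
      using image_eqI[of s "\<lambda>t. k (h t)", OF 2[OF that, symmetric] gg[OF that]] .
  qed
  moreover have "(\<lambda>s. g (g' s)) ` W' = W"
  proof (intro equalityI image_subsetI subsetI)
    show "g (g' t) \<in> W" if "t \<in> W'" for t using gg[OF that] .
    show "s \<in> (\<lambda>s. g (g' s)) ` W'" if "s \<in> W" for s
      using image_eqI[of s "\<lambda>s. g (g' s)", OF 1[OF that, symmetric] kh[OF that]] .
  qed
  moreover have "cdiff_M (\<lambda>t. k (h t) $ i) t" if "t \<in> W" for t i
    using that h(10) k(10) by (intro cdiff_M_compose[of h _ "\<lambda>s. k s $ i"]) (auto simp: W_def)
  moreover have "cdiff_M (\<lambda>t. g (g' t) $ i) t" if "t \<in> W'" for t i
    using that h(11) k(11) by (intro cdiff_M_compose[of g' _ "\<lambda>s. g s $ i"]) (auto simp: W'_def)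
  ultimately show ?thesis
    unfolding biholomorphic_germ_def holM_on_iff using h(1) k(1)
    by (intro conjI exI[of _ W] exI[of _ W'] exI[of _ "\<lambda>s. g (g' s)"] ballI allI) simp_all
qed

text \<open>The combined equation is the sum of the equations for \<open>T2\<close> with weights
  \<open>p j\<close>, multiplied by \<open>T1\<close> on the right, plus \<open>T2\<close> times the
  equation for \<open>T1\<close>. The intermediate matrices \<open>B j\<close> cancel.\<close>

lemma gauge_compose_identity:
  fixes T1 T2 D1 A :: "complex^2^2" and B C D K :: "2 \<Rightarrow> complex^2^2" and k :: "2 \<Rightarrow> 2 \<Rightarrow> complex"
  assumes E1: "mat z ** D1 + (\<Sum>j\<in>UNIV. mat (p j) ** B j) ** T1 - T1 ** A = 0"
    and E2: "\<And>j. mat z ** D j + (\<Sum>l\<in>UNIV. mat (k l j) ** C l) ** T2 - T2 ** B j = 0"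
  shows "mat z ** ((\<Sum>j\<in>UNIV. mat (p j) ** D j) ** T1 + T2 ** D1)
      + (\<Sum>l\<in>UNIV. mat (\<Sum>j\<in>UNIV. p j * k l j) ** C l) ** (T2 ** T1) - (T2 ** T1) ** A = 0"
proof -
  let ?E2 = "\<lambda>j. mat z ** D j + (\<Sum>l\<in>UNIV. mat (k l j) ** C l) ** T2 - T2 ** B j"
  let ?E1 = "mat z ** D1 + (\<Sum>j\<in>UNIV. mat (p j) ** B j) ** T1 - T1 ** A"
  have "mat z ** ((\<Sum>j\<in>UNIV. mat (p j) ** D j) ** T1 + T2 ** D1)
      + (\<Sum>l\<in>UNIV. mat (\<Sum>j\<in>UNIV. p j * k l j) ** C l) ** (T2 ** T1) - (T2 ** T1) ** A
    = (\<Sum>j\<in>UNIV. mat (p j) ** ?E2 j) ** T1 + T2 ** ?E1"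
    by (simp add: vec_eq_iff forall_2 matrix_matrix_mult_def mat_def sum_2 algebra_simps)
  then show ?thesis by (simp only: E1 E2) simp
qed

theorem hol_isomorphism_compose:
  assumes "hol_isomorphism A B h T" "hol_isomorphism B C k S"
  shows "hol_isomorphism A C (\<lambda>t. k (h t)) (\<lambda>p. S (fst p, h (snd p)) ** T p)"
proof -
  have h: "biholomorphic_germ h" and k: "biholomorphic_germ k"
    and T: "\<forall>\<^sub>F p in nhds 0. \<forall>a b. cdiff_CM (\<lambda>p. T p $ a $ b) p"
    and S: "\<forall>\<^sub>F p in nhds 0. \<forall>a b. cdiff_CM (\<lambda>p. S p $ a $ b) p"
    and invT: "\<forall>\<^sub>F t in nhds 0. invertible (T (0, t))"
    and invS: "\<forall>\<^sub>F t in nhds 0. invertible (S (0, t))"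
    and eqT: "\<And>i. \<forall>\<^sub>F p in nhds 0. mat (fst p) ** pd_mat i (\<lambda>s. T (fst p, s)) (snd p)
        + (\<Sum>j\<in>UNIV. mat (pd i (\<lambda>s. h s $ j) (snd p)) ** B j (fst p, h (snd p))) ** T (fst p, snd p)
        - T (fst p, snd p) ** A i (fst p, snd p) = 0"
    and eqS: "\<And>i. \<forall>\<^sub>F p in nhds 0. mat (fst p) ** pd_mat i (\<lambda>s. S (fst p, s)) (snd p)
        + (\<Sum>j\<in>UNIV. mat (pd i (\<lambda>s. k s $ j) (snd p)) ** C j (fst p, k (snd p))) ** S (fst p, snd p)
        - S (fst p, snd p) ** B i (fst p, snd p) = 0"
    using assms unfolding hol_isomorphism_def germ_tz_iff case_prod_unfold
    by (auto simp: eventually_all_finite)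
  note hlim = biholomorphic_germ_filterlim[OF h]
  \<comment> \<open>The data of the second isomorphism are evaluated at \<open>h(t)\<close>, hence
    their eventual properties are pulled back along the limit of \<open>h\<close> at the
    origin.\<close>
  have ev: "\<forall>\<^sub>F p in nhds 0. (\<forall>a b. cdiff_CM (\<lambda>p. T p $ a $ b) p) \<and>
      (\<forall>a b. cdiff_CM (\<lambda>p. S p $ a $ b) (fst p, h (snd p))) \<and>
      (\<forall>j. cdiff_M (\<lambda>s. h s $ j) (snd p)) \<and> (\<forall>j. cdiff_M (\<lambda>s. k s $ j) (h (snd p)))"
    by (intro eventually_conj T eventually_pair_compose[OF S hlim]
        eventually_nhds_0_snd[OF biholomorphic_germ_cdiff[OF h]]
        eventually_nhds_0_snd[OF eventually_compose_filterlim[OF biholomorphic_germ_cdiff[OF k] hlim]])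
  have eqS': "\<forall>\<^sub>F p in nhds 0. \<forall>i. mat (fst p) ** pd_mat i (\<lambda>s. S (fst p, s)) (h (snd p))
      + (\<Sum>j\<in>UNIV. mat (pd i (\<lambda>s. k s $ j) (h (snd p))) ** C j (fst p, k (h (snd p)))) **
        S (fst p, h (snd p)) - S (fst p, h (snd p)) ** B i (fst p, h (snd p)) = 0"
    using eventually_pair_compose[OF eqS hlim] by (intro eventually_all_finite) simp
  show ?thesis
    unfolding hol_isomorphism_def case_prod_unfold
  proof (intro conjI allI)
    show "biholomorphic_germ (\<lambda>t. k (h t))" by (rule biholomorphic_germ_compose[OF h k])
    show "germ_tz (\<lambda>p. (S (fst p, h (snd p)) ** T p) $ a $ b)" for a b
      unfolding germ_tz_iff using ev
    proof eventually_elim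
      case (elim p)
      then have "cdiff_CM (\<lambda>p. S (fst p, h (snd p)) $ a $ c) p" "cdiff_CM (\<lambda>p. T p $ c $ b) p" for c
        using cdiff_CM_compose[of h p "\<lambda>p. S p $ a $ c"] by auto
      then show ?case
        by (simp add: matrix_matrix_mult_def sum_2 cdiff_CM_add cdiff_CM_mult)
    qed
    show "\<forall>\<^sub>F t in nhds 0. invertible (S (fst (0, t), h (snd (0, t))) ** T (0, t))"
      using invT eventually_compose_filterlim[OF invS hlim]
      by eventually_elim (simp add: invertible_mult)
    fix i
    show "\<forall>\<^sub>F p in nhds 0. mat (fst p) ** pd_mat i (\<lambda>s. S (fst (fst p, s), h (snd (fst p, s))) ** T (fst p, s)) (snd p)
        + (\<Sum>j\<in>UNIV. mat (pd i (\<lambda>s. k (h s) $ j) (snd p)) ** C j (fst p, k (h (snd p)))) **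
          (S (fst (fst p, snd p), h (snd (fst p, snd p))) ** T (fst p, snd p))
        - (S (fst (fst p, snd p), h (snd (fst p, snd p))) ** T (fst p, snd p)) ** A i (fst p, snd p) = 0"
      using ev eqT[of i] eqS'
    proof eventually_elim
      case (elim p)
      obtain z t where p: "p = (z, t)" by (cases p)
      have cd: "cdiff_M (\<lambda>s. T (z, s) $ a $ b) t" "cdiff_M (\<lambda>s. S (z, s) $ a $ b) (h t)"
        "cdiff_M (\<lambda>s. h s $ j) t" "cdiff_M (\<lambda>s. k s $ j) (h t)" for a b j
        using elim(1) cdiff_CM_slice(1)[of "\<lambda>p. T p $ a $ b" z t]
          cdiff_CM_slice(1)[of "\<lambda>p. S p $ a $ b" z "h t"] by (auto simp: p)
      have dST: "pd_mat i (\<lambda>s. S (z, h s) ** T (z, s)) t =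
          (\<Sum>j\<in>UNIV. mat (pd i (\<lambda>s. h s $ j) t) ** pd_mat j (\<lambda>s. S (z, s)) (h t)) ** T (z, t)
          + S (z, h t) ** pd_mat i (\<lambda>s. T (z, s)) t"
        using cd pd_mat_compose[of h t "\<lambda>s. S (z, s)"]
        by (subst pd_mat_mult) (auto intro: cdiff_M_compose[of h t "\<lambda>s. S (z, s) $ _ $ _"])
      have dk: "pd i (\<lambda>s. k (h s) $ l) t =
          (\<Sum>j\<in>UNIV. pd i (\<lambda>s. h s $ j) t * pd j (\<lambda>s. k s $ l) (h t))" for l
        using cd by (intro pd_compose[of h t "\<lambda>s. k s $ l"]) auto
      show ?case
        unfolding p fst_conv snd_conv dST dk
        by (rule gauge_compose_identity) (use elim(2,3) in \<open>simp_all add: p\<close>)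
    qed
  qed
qed

lemma hol_isomorphic_trans:
  "hol_isomorphic A B \<Longrightarrow> hol_isomorphic B C \<Longrightarrow> hol_isomorphic A C"
  unfolding hol_isomorphic_def by (blast intro: hol_isomorphism_compose)


subsection \<open>Changes of the coordinate of a normal form\<close>

lemma germ_t2z_iff:
  "germ_t2z f \<longleftrightarrow> (\<forall>\<^sub>F p in nhds 0. cdiff_CM (\<lambda>p. f (snd p $ 2) (fst p)) p)"
  unfolding germ_t2z_def germ_tz_iff case_prod_unfold ..

lemma matrix_2_eqI:
  fixes A B :: "'a^2^2"
  assumes "A $ 1 $ 1 = B $ 1 $ 1" "A $ 1 $ 2 = B $ 1 $ 2" "A $ 2 $ 1 = B $ 2 $ 1" "A $ 2 $ 2 = B $ 2 $ 2"
  shows "A = B"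
  using assms by (simp add: vec_eq_iff forall_2)

lemma normal_form_1: "normal_form f 1 p = mat 1"
  by (simp add: normal_form_def case_prod_unfold)

lemma normal_form_2:
  "normal_form f 2 p = vector [vector [0, fst p * f (snd p $ 2) (fst p)], vector [1, 0]]"
  by (simp add: normal_form_def case_prod_unfold C2_def E_def matrix_matrix_mult_def mat_def
      vec_eq_iff forall_2 sum_2)

text \<open>Both \<open>a\<close> and \<open>\<rho>\<close> are inputs, tied by
  \<open>\<rho>' = 1/a^2\<close>, because the two normalizations produce them in opposite order:
  once \<open>a\<close> solves a linear equation and \<open>\<rho>\<close> is a primitive, once
  \<open>a\<close> is a root of the derivative of a known \<open>\<rho>\<close>. The explicit
  formula for \<open>f\<close> is returned because its first coefficients are read off
  later.\<close>

lemma normal_form_change_of_variable: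
  fixes a \<rho> :: "complex \<Rightarrow> complex"
  assumes g: "germ_t2z g"
    and a: "a analytic_on {0}" "a 0 \<noteq> 0"
    and \<rho>: "\<rho> analytic_on {0}" "\<rho> 0 = 0"
    and d\<rho>: "\<forall>\<^sub>F s in nhds 0. deriv \<rho> s = 1 / (a s)\<^sup>2"
  obtains f \<mu> where "germ_t2z f" "hol_isomorphic (normal_form g) (normal_form f)"
    "\<mu> analytic_on {0}" "\<mu> 0 = 0" "\<forall>\<^sub>F s in nhds 0. \<rho> (\<mu> s) = s"
    "\<And>s z. f s z = (g (\<mu> s) z - z * deriv (deriv a) (\<mu> s) / a (\<mu> s)) * a (\<mu> s) ^ 4"
proof -
  obtain A where A: "open A" "0 \<in> A" "a holomorphic_on A" using a by (auto simp: analytic_at)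
  obtain L where L: "open L" "0 \<in> L" "\<rho> holomorphic_on L" using \<rho> by (auto simp: analytic_at)
  have "\<forall>\<^sub>F s in nhds 0. a s \<noteq> 0"
    by (rule analytic_eventually_nonzero[OF a])
  then have "\<forall>\<^sub>F s in nhds 0. s \<in> A \<and> s \<in> L \<and> a s \<noteq> 0 \<and> deriv \<rho> s = 1 / (a s)\<^sup>2"
    using A L d\<rho> by (intro eventually_conj eventually_nhds_in_open) auto
  then obtain S where S: "open S" "0 \<in> S" "S \<subseteq> A" "S \<subseteq> L" "\<And>s. s \<in> S \<Longrightarrow> a s \<noteq> 0"
    "\<And>s. s \<in> S \<Longrightarrow> deriv \<rho> s = 1 / (a s)\<^sup>2"
    unfolding eventually_nhds by blast
  have hol: "a holomorphic_on S" "\<rho> holomorphic_on S"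
    using A L S by (auto intro: holomorphic_on_subset)
  \<comment> \<open>A nonzero derivative makes \<open>\<rho>\<close> injective near the origin,
    which provides the holomorphic inverse \<open>\<mu>\<close>.\<close>
  have "deriv \<rho> 0 \<noteq> 0" using S a by auto
  then obtain r where r: "r > 0" "ball 0 r \<subseteq> S" "inj_on \<rho> (ball 0 r)"
    using has_complex_derivative_locally_injective[OF hol(2) S(2,1)] by blast
  define D where "D = ball (0::complex) r"
  have D: "open D" "0 \<in> D" "D \<subseteq> S" using r by (auto simp: D_def)
  have hol_D: "a holomorphic_on D" "\<rho> holomorphic_on D"
    using hol D by (auto intro: holomorphic_on_subset)
  obtain \<mu> where \<mu>: "\<mu> holomorphic_on \<rho> ` D" "\<And>s. s \<in> D \<Longrightarrow> \<mu> (\<rho> s) = s"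
    using holomorphic_has_inverse[OF hol_D(2) D(1)] r(3) unfolding D_def by metis
  have oD: "open (\<rho> ` D)"
    using r(3) D hol_D by (intro open_mapping_thm3) (auto simp: D_def)
  have D0: "0 \<in> \<rho> ` D" using D \<rho>(2) by (metis image_eqI)
  have \<mu>0: "\<mu> 0 = 0" using \<mu>(2)[OF D(2)] \<rho> by simp
  have \<rho>\<mu>: "\<rho> (\<mu> s) = s" if "s \<in> \<rho> ` D" for s using that \<mu>(2) by auto
  have \<mu>D: "\<mu> s \<in> D" if "s \<in> \<rho> ` D" for s using that \<mu>(2) by auto
  \<comment> \<open>The upper right entry of the gauge equation prescribes \<open>f\<close> at
    \<open>\<rho>(s)\<close>; substituting \<open>\<mu>\<close> expresses it in the new
    coordinate.\<close>
  define f where "f s z = (g (\<mu> s) z - z * deriv (deriv a) (\<mu> s) / a (\<mu> s)) * a (\<mu> s) ^ 4" for s z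
  define h :: "complex^2 \<Rightarrow> complex^2" where "h t = vector [t $ 1, \<rho> (t $ 2)]" for t
  define k :: "complex^2 \<Rightarrow> complex^2" where "k t = vector [t $ 1, \<mu> (t $ 2)]" for t
  define T :: "complex \<times> (complex^2) \<Rightarrow> complex^2^2" where
    "T p = vector [vector [a (snd p $ 2), fst p * deriv a (snd p $ 2)],
                   vector [0, inverse (a (snd p $ 2))]]" for p
  have fd: "F field_differentiable (at s)" if "F holomorphic_on D" "s \<in> D" for F s
    using that D(1) holomorphic_on_imp_differentiable_at by blast
  have cd: "cdiff_M (\<lambda>t. F (t $ 2)) t" if "F holomorphic_on D" "t $ 2 \<in> D" for F t
    using that by (intro cdiff_M_compose_field[OF cdiff_M_nth]) (auto intro: fd)
  have pdc: "pd i (\<lambda>t. F (t $ 2)) t = deriv F (t $ 2) * (if i = 2 then 1 else 0)"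
    if "F holomorphic_on D" "t $ 2 \<in> D" for F t i
    using pd_compose_field[OF cdiff_M_nth holomorphic_derivI[OF that(1) D(1) that(2)], of i]
    by (simp add: pd_nth)
  have hol_a: "a holomorphic_on D" "deriv a holomorphic_on D" "deriv (deriv a) holomorphic_on D"
    "(\<lambda>s. inverse (a s)) holomorphic_on D"
    using hol_D D S(5) by (auto intro!: holomorphic_intros)
  have h_cd: "cdiff_M (\<lambda>t. h t $ j) t" if "t $ 2 \<in> D" for j t
    using exhaust_2[of j] cd[OF hol_D(2) that] by (auto simp: h_def)
  have k_cd: "cdiff_M (\<lambda>t. k t $ j) t" if "t $ 2 \<in> \<rho> ` D" for j t
    using exhaust_2[of j] that \<mu>(1) oD
    by (auto simp: k_def intro!: cdiff_M_compose_field[of "\<lambda>t. t $ 2" t \<mu>] holomorphic_on_imp_differentiable_at)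
  have ev_D: "\<forall>\<^sub>F t in nhds 0. (t :: complex^2) $ 2 \<in> B" if "open B" "0 \<in> B" for B
  proof -
    have "open ((\<lambda>t :: complex^2. t $ 2) -` B)" by (intro open_vimage_vec_nth that)
    then have "\<forall>\<^sub>F t in nhds 0. t \<in> (\<lambda>t :: complex^2. t $ 2) -` B"
      using that by (intro eventually_nhds_in_open) auto
    then show ?thesis by simp
  qed
  have h0: "h 0 = 0" using \<rho> by (simp add: h_def vec_eq_iff forall_2)
  have bh: "biholomorphic_germ h"
    unfolding biholomorphic_germ_def holM_on_iff
  proof (rule conjI[OF h0 exI[of _ "(\<lambda>t. t $ 2) -` D", OF exI[of _ "(\<lambda>t. t $ 2) -` (\<rho> ` D)",
          OF exI[of _ k]]]], intro conjI allI ballI)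
    show "open ((\<lambda>t. t $ 2) -` D :: (complex^2) set)" "open ((\<lambda>t. t $ 2) -` (\<rho> ` D) :: (complex^2) set)"
      using D(1) oD by (auto intro: open_vimage_vec_nth)
    show hk: "k (h t) = t" if "t \<in> (\<lambda>t. t $ 2) -` D" for t
      using that \<mu>(2) by (simp add: k_def h_def vec_eq_iff forall_2)
    show kh: "h (k t) = t" if "t \<in> (\<lambda>t. t $ 2) -` (\<rho> ` D)" for t
      using that \<rho>\<mu> by (simp add: k_def h_def vec_eq_iff forall_2)
    have hD: "h t \<in> (\<lambda>t. t $ 2) -` (\<rho> ` D)" if "t \<in> (\<lambda>t. t $ 2) -` D" for t
      using that by (simp add: h_def)
    have kD: "k t \<in> (\<lambda>t. t $ 2) -` D" if "t \<in> (\<lambda>t. t $ 2) -` (\<rho> ` D)" for t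
      using that \<mu>D by (simp add: k_def)
    show "h ` ((\<lambda>t. t $ 2) -` D) = (\<lambda>t. t $ 2) -` (\<rho> ` D)"
      "k ` ((\<lambda>t. t $ 2) -` (\<rho> ` D)) = (\<lambda>t. t $ 2) -` D"
      using hD kD hk kh by (intro equalityI image_subsetI subsetI; metis image_eqI)+
  qed (use D(2) D0 h_cd k_cd in auto)
  have g': "\<forall>\<^sub>F p in nhds 0. cdiff_CM (\<lambda>p. g (snd p $ 2) (fst p)) (fst p, k (snd p))"
  proof (rule eventually_pair_compose)
    show "filterlim k (nhds 0) (nhds 0)"
      using D0 k_cd[of 0] by (intro filterlim_nhds_0_M isCont_vecI cdiff_M_imp_isCont)
        (auto simp: k_def \<mu>0 vec_eq_iff forall_2)
  qed (use g in \<open>simp add: germ_t2z_iff\<close>)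
  have gf: "germ_t2z f"
    unfolding germ_t2z_iff using g' eventually_nhds_0_snd[OF ev_D[OF oD D0]]
  proof eventually_elim
    case (elim p)
    have "cdiff_CM (\<lambda>p. g (\<mu> (snd p $ 2)) (fst p)) p"
      using cdiff_CM_compose[OF k_cd[OF elim(2)] elim(1)] by (simp add: k_def)
    moreover have "cdiff_CM (\<lambda>p. F (\<mu> (snd p $ 2))) p" if "F holomorphic_on D" for F
    proof -
      have "cdiff_M (\<lambda>t. F (k t $ 2)) (snd p)"
        using elim(2) by (intro cdiff_M_compose_field[OF k_cd] fd that) (auto simp: k_def \<mu>D)
      then show ?thesis using cdiff_CM_snd[of "\<lambda>t. F (k t $ 2)"] by (simp add: k_def)
    qed
    \<comment> \<open>The coefficient \<open>-a''/a\<close> is treated as one holomorphic function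
      of the coordinate, which reduces \<open>f\<close> to sums and products of functions already
      known to be holomorphic.\<close>
    note this[of "\<lambda>s. - (deriv (deriv a) s * inverse (a s))"] this[of "\<lambda>s. a s ^ 4"]
    moreover have "(\<lambda>s. - (deriv (deriv a) s * inverse (a s))) holomorphic_on D"
      "(\<lambda>s. a s ^ 4) holomorphic_on D"
      by (intro holomorphic_intros hol_a)+
    ultimately have "cdiff_CM (\<lambda>p. (g (\<mu> (snd p $ 2)) (fst p) +
        fst p * - (deriv (deriv a) (\<mu> (snd p $ 2)) * inverse (a (\<mu> (snd p $ 2))))) * a (\<mu> (snd p $ 2)) ^ 4) p"
      by (intro cdiff_CM_mult cdiff_CM_add cdiff_CM_fst) auto
    then show ?case by (simp add: f_def divide_inverse mult.assoc)
  qed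
  have "hol_isomorphism (normal_form g) (normal_form f) h T"
    unfolding hol_isomorphism_def case_prod_unfold
  proof (intro conjI allI bh)
    show "germ_tz (\<lambda>p. T p $ i $ j)" for i j
      unfolding germ_tz_iff using eventually_nhds_0_snd[OF ev_D[OF D(1,2)]]
    proof eventually_elim
      case (elim p)
      note c = cdiff_CM_snd[OF cd[OF hol_a(1) elim]] cdiff_CM_snd[OF cd[OF hol_a(2) elim]]
        cdiff_CM_snd[OF cd[OF hol_a(4) elim]] cdiff_CM_snd[OF cdiff_M_const[of 0 "snd p"]]
      show ?case using exhaust_2[of i] exhaust_2[of j] c
        by (auto simp: T_def intro!: cdiff_CM_mult)
    qed
    show "\<forall>\<^sub>F t in nhds 0. invertible (T (0, t))"
      using ev_D[OF D(1,2)]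
    proof eventually_elim
      case (elim t)
      then have "a (t $ 2) \<noteq> 0" using S(5) D(3) by blast
      then show ?case by (simp add: invertible_det_nz det_2 T_def)
    qed
    fix i :: 2
    show "\<forall>\<^sub>F p in nhds 0. mat (fst p) ** pd_mat i (\<lambda>s. T (fst p, s)) (snd p)
        + (\<Sum>j\<in>UNIV. mat (pd i (\<lambda>s. h s $ j) (snd p)) ** normal_form f j (fst p, h (snd p))) ** T (fst p, snd p)
        - T (fst p, snd p) ** normal_form g i (fst p, snd p) = 0"
      using eventually_nhds_0_snd[OF ev_D[OF D(1,2)]]
    proof eventually_elim
      case (elim p)
      obtain z t where p: "p = (z, t)" by (cases p)
      have t: "t $ 2 \<in> D" using elim p by simp
      have a0: "a (t $ 2) \<noteq> 0" using S(5) D(3) t by blast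
      have dinv: "deriv (\<lambda>s. inverse (a s)) (t $ 2) = - deriv a (t $ 2) / (a (t $ 2))\<^sup>2"
        using fd[OF hol_a(1) t] a0 by simp
      have pdz: "pd i (\<lambda>s. z * deriv a (s $ 2)) t = z * deriv (deriv a) (t $ 2) * (if i = 2 then 1 else 0)"
        using pd_mult[OF cdiff_M_const[of z] cd[OF hol_a(2) t]] pdc[OF hol_a(2) t] by simp
      have pdT: "pd_mat i (\<lambda>s. T (z, s)) t = mat (if i = 2 then 1 else 0) **
          vector [vector [deriv a (t $ 2), z * deriv (deriv a) (t $ 2)],
                  vector [0, - deriv a (t $ 2) / (a (t $ 2))\<^sup>2]]"
        by (rule matrix_2_eqI)
          (simp_all add: pd_mat_def T_def pdz pdc[OF hol_a(1) t] pdc[OF hol_a(4) t] dinv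
            matrix_matrix_mult_def mat_def sum_2)
      have pdh: "pd i (\<lambda>s. h s $ 1) t = (if i = 1 then 1 else 0)"
        "pd i (\<lambda>s. h s $ 2) t = (if i = 2 then 1 / (a (t $ 2))\<^sup>2 else 0)"
        using pdc[OF hol_D(2) t] S(6) D(3) t by (auto simp: h_def pd_nth)
      have ft: "f (\<rho> (t $ 2)) z =
          (g (t $ 2) z - z * deriv (deriv a) (t $ 2) / a (t $ 2)) * a (t $ 2) ^ 4"
        using \<mu>(2)[OF t] by (simp add: f_def)
      consider "i = 1" | "i = 2" using exhaust_2 by blast
      then show ?case
      proof cases
        case 1
        \<comment> \<open>In the unit direction both connection matrices are the identity, and
          \<open>T\<close> does not depend on \<open>t_1\<close>.\<close>
        have "mat z ** pd_mat i (\<lambda>s. T (z, s)) t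
          + (\<Sum>j\<in>UNIV. mat (pd i (\<lambda>s. h s $ j) t) ** normal_form f j (z, h t)) ** T (z, t)
          - T (z, t) ** normal_form g i (z, t) = 0"
          unfolding pdT sum_2 pdh using 1 by (simp add: normal_form_1)
        then show ?thesis by (simp add: p)
      next
        case 2
        \<comment> \<open>On the diagonal, \<open>z a'\<close> cancels against the entry of
          \<open>T C2\<close>, and the derivative \<open>-a'/a^2\<close> of \<open>1/a\<close>
          against the entry of \<open>\<rho>' C2 T\<close>. The upper right entry is the defining
          formula of \<open>f\<close>.\<close>
        have "mat z ** pd_mat i (\<lambda>s. T (z, s)) t
          + (\<Sum>j\<in>UNIV. mat (pd i (\<lambda>s. h s $ j) t) ** normal_form f j (z, h t)) ** T (z, t)
          - T (z, t) ** normal_form g i (z, t) = 0"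
          unfolding pdT sum_2 pdh using 2 a0
          by (intro matrix_2_eqI)
            (simp_all add: normal_form_1 normal_form_2 h_def T_def ft matrix_matrix_mult_def mat_def
              sum_2 field_simps power2_eq_square power4_eq_xxxx)
        then show ?thesis by (simp add: p)
      qed
    qed
  qed
  then have "hol_isomorphic (normal_form g) (normal_form f)"
    by (auto simp: hol_isomorphic_def)
  moreover have "\<mu> analytic_on {0}" using \<mu>(1) oD D0 by (auto simp: analytic_at)
  moreover have "\<forall>\<^sub>F s in nhds 0. \<rho> (\<mu> s) = s"
    using eventually_nhds_in_open[OF oD D0] by eventually_elim (rule \<rho>\<mu>)
  ultimately show thesis using that[OF gf] \<mu>0 f_def by blast
qed


subsection \<open>Analytic solutions of differential equations\<close>

lemma fps_conv_radius_posI: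
  fixes F :: "complex fps"
  assumes "\<And>n. norm (fps_nth F n) \<le> C * K ^ n" "K \<ge> 1"
  shows "fps_conv_radius F > 0"
proof -
  \<comment> \<open>At this point the ratio of the majorizing geometric series is
    \<open>1/2\<close>.\<close>
  define z where "z = complex_of_real (1 / (2 * K))"
  have nz: "norm z = 1 / (2 * K)" using assms(2) by (simp only: z_def norm_of_real) simp
  have "summable (\<lambda>n. fps_nth F n * z ^ n)"
  proof (rule summable_comparison_test)
    have "norm (fps_nth F n * z ^ n) \<le> C * (1 / 2) ^ n" for n
    proof -
      have "norm (fps_nth F n * z ^ n) \<le> C * K ^ n * (1 / (2 * K)) ^ n"
        using assms by (simp add: norm_mult norm_power nz mult_right_mono)
      also have "\<dots> = C * (1 / 2) ^ n" using assms(2) by (simp add: power_divide power_mult_distrib)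
      finally show ?thesis .
    qed
    then show "\<exists>N. \<forall>n\<ge>N. norm (fps_nth F n * z ^ n) \<le> C * (1 / 2) ^ n" by blast
    show "summable (\<lambda>n. C * (1 / 2 :: real) ^ n)" by (intro summable_mult summable_geometric) simp
  qed
  then have "fps_conv_radius F \<ge> norm z"
    unfolding fps_conv_radius_def by (rule conv_radius_geI)
  moreover have "0 < ereal (norm z)" using assms(2) by (simp add: nz)
  ultimately show ?thesis by (metis less_le_trans)
qed

text \<open>The terms of a convergent series at some \<open>r > 0\<close> are bounded. The same
  constant serves as factor and as ratio, so that recursive estimates involve only one
  number.\<close>

lemma fps_nth_geometric_bound:
  fixes F :: "complex fps"
  assumes "fps_conv_radius F > 0"
  obtains K where "K \<ge> 1" "\<And>n. norm (fps_nth F n) \<le> K * K ^ n"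
proof -
  obtain r where r: "0 < ereal r" "ereal r < fps_conv_radius F"
    using ereal_dense2[OF assms] by auto
  then have "r > 0" by simp
  have "summable (\<lambda>n. norm (fps_nth F n * of_real r ^ n))"
    using r \<open>r > 0\<close> by (intro norm_summable_fps) simp
  then have "(\<lambda>n. norm (fps_nth F n * of_real r ^ n)) \<longlonglongrightarrow> 0" by (rule summable_LIMSEQ_zero)
  then have "\<exists>M. \<forall>n. norm (fps_nth F n) * r ^ n \<le> M"
    using \<open>r > 0\<close> by (auto dest!: convergentI convergent_imp_Bseq simp: Bseq_def norm_mult norm_power) blast
  then obtain M where M: "\<And>n. norm (fps_nth F n) * r ^ n \<le> M" by blast
  define K where "K = Max {1, 1 / r, M}"
  have K: "K \<ge> 1" "K \<ge> 1 / r" "K \<ge> M" by (auto simp: K_def)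
  have "norm (fps_nth F n) \<le> K * K ^ n" for n
  proof -
    have "norm (fps_nth F n) = norm (fps_nth F n) * r ^ n * (1 / r) ^ n"
      using \<open>r > 0\<close> by (simp add: power_divide)
    also have "\<dots> \<le> K * K ^ n"
      using M[of n] K \<open>r > 0\<close> by (intro mult_mono power_mono) auto
    finally show ?thesis .
  qed
  with K(1) show thesis by (rule that)
qed

lemma has_fps_expansion_eval_fps_self:
  fixes F :: "complex fps"
  assumes "fps_conv_radius F > 0"
  shows "eval_fps F has_fps_expansion F"
  using assms by (simp add: has_fps_expansion_def)

lemma has_fps_expansion_imp_eventually_eq:
  assumes "f has_fps_expansion F" "g has_fps_expansion F"
  shows "\<forall>\<^sub>F z in nhds 0. f z = g z"
proof -
  have "\<forall>\<^sub>F z in nhds 0. eval_fps F z = f z" "\<forall>\<^sub>F z in nhds 0. eval_fps F z = g z"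
    using assms by (auto simp: has_fps_expansion_def)
  then show ?thesis by eventually_elim simp
qed

section \<open>Power series solution of \<open>a'' = q a\<close> with \<open>a(0) = 1\<close> and
  \<open>a'(0) = 0\<close>\<close>

fun ode_coeff :: "(nat \<Rightarrow> complex) \<Rightarrow> nat \<Rightarrow> complex" where
  "ode_coeff q 0 = 1"
| "ode_coeff q (Suc 0) = 0"
| "ode_coeff q (Suc (Suc n)) = (\<Sum>k\<le>n. q k * ode_coeff q (n - k)) / (of_nat (Suc n) * of_nat (Suc (Suc n)))"

text \<open>In the recursion the \<open>m + 1\<close> convolution terms are each at most
  \<open>K^(m+1)\<close>, and their number is compensated by the factor \<open>m + 1\<close> of the
  denominator.\<close>

lemma norm_ode_coeff_le:
  assumes q: "\<And>n. norm (q n) \<le> K * K ^ n" and "K \<ge> 1"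
  shows "norm (ode_coeff q n) \<le> K ^ n"
proof (induction n rule: less_induct)
  case (less n)
  consider "n = 0" | "n = 1" | m where "n = Suc (Suc m)"
    by (metis One_nat_def not0_implies_Suc)
  then show ?case
  proof cases
    case 3
    have "norm (\<Sum>k\<le>m. q k * ode_coeff q (m - k)) \<le> (\<Sum>k\<le>m. K * K ^ m)"
    proof (intro sum_norm_le)
      fix k assume k: "k \<in> {..m}"
      have "norm (q k * ode_coeff q (m - k)) \<le> (K * K ^ k) * K ^ (m - k)"
        unfolding norm_mult using k 3 assms by (intro mult_mono less.IH) auto
      also have "\<dots> = K * K ^ m" using k by (simp flip: power_add)
      finally show "norm (q k * ode_coeff q (m - k)) \<le> K * K ^ m" .
    qed
    also have "\<dots> = real (Suc m) * (K * K ^ m)" by simp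
    finally have "norm (ode_coeff q n) \<le> real (Suc m) * (K * K ^ m) / (real (Suc m) * real (Suc (Suc m)))"
      unfolding 3 ode_coeff.simps norm_divide norm_mult norm_of_nat by (intro divide_right_mono) auto
    also have "\<dots> = K * K ^ m / real (Suc (Suc m))" by simp
    also have "\<dots> \<le> K * K ^ m / 1" using \<open>K \<ge> 1\<close> by (intro divide_left_mono) auto
    also have "\<dots> \<le> K ^ n" using \<open>K \<ge> 1\<close> by (simp add: 3 mult_left_le_imp_le)
    finally show ?thesis .
  qed (use \<open>K \<ge> 1\<close> in auto)
qed

text \<open>The coefficients are majorized by a geometric sequence, so the formal solution
  converges. The initial value 1 makes \<open>a\<close> a unit, as required of a diagonal entry of
  the gauge matrix.\<close>

lemma analytic_second_order_ode:
  assumes "q analytic_on {0 :: complex}"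
  obtains a where "a analytic_on {0}" "a 0 = 1" "\<forall>\<^sub>F s in nhds 0. deriv (deriv a) s = q s * a s"
proof -
  define Q where "Q = fps_expansion q 0"
  have Q: "q has_fps_expansion Q"
    unfolding Q_def using assms by (rule analytic_at_imp_has_fps_expansion_0)
  obtain K where K: "K \<ge> 1" "\<And>n. norm (fps_nth Q n) \<le> K * K ^ n"
    using fps_nth_geometric_bound Q unfolding has_fps_expansion_def by metis
  define A where "A = Abs_fps (ode_coeff (fps_nth Q))"
  have "fps_conv_radius A > 0"
    using norm_ode_coeff_le[of "fps_nth Q", OF K(2,1)] K(1)
    by (intro fps_conv_radius_posI[of _ 1 K]) (simp_all add: A_def)
  then have A: "eval_fps A has_fps_expansion A" by (rule has_fps_expansion_eval_fps_self)
  have eq: "fps_deriv (fps_deriv A) = Q * A"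
  proof (rule fps_ext)
    fix n
    have "complex_of_nat (Suc n) * of_nat (Suc (Suc n)) \<noteq> 0"
      by (simp only: of_nat_eq_0_iff mult_eq_0_iff) simp
    then show "fps_nth (fps_deriv (fps_deriv A)) n = fps_nth (Q * A) n"
      by (simp add: fps_mult_nth A_def atLeast0AtMost del: of_nat_Suc)
  qed
  have "deriv (deriv (eval_fps A)) has_fps_expansion Q * A"
    unfolding eq[symmetric] by (intro has_fps_expansion_deriv A)
  moreover have "(\<lambda>s. q s * eval_fps A s) has_fps_expansion Q * A"
    by (intro has_fps_expansion_mult A Q)
  ultimately have "\<forall>\<^sub>F s in nhds 0. deriv (deriv (eval_fps A)) s = q s * eval_fps A s"
    by (rule has_fps_expansion_imp_eventually_eq)
  moreover have "eval_fps A 0 = 1" by (simp add: eval_fps_at_0 A_def)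
  ultimately show thesis using that has_fps_expansion_imp_analytic_0[OF A] by blast
qed

text \<open>The equation is singular at the origin, but in coefficients it reads
  \<open>(n + m) w_n = m v_n\<close>. Positivity of \<open>m\<close> excludes resonances, and the
  factors \<open>m / (n + m)\<close> are at most 1, so convergence is inherited from
  \<open>v\<close>; the case \<open>n = 0\<close> gives the value at the origin.\<close>

lemma analytic_euler_ode:
  fixes m :: real
  assumes "v analytic_on {0 :: complex}" "m > 0"
  obtains w where "w analytic_on {0}" "w 0 = v 0"
    "\<forall>\<^sub>F s in nhds 0. s * deriv w s + of_real m * w s = of_real m * v s"
proof -
  define V where "V = fps_expansion v 0"
  have V: "v has_fps_expansion V"
    unfolding V_def using assms(1) by (rule analytic_at_imp_has_fps_expansion_0)
  obtain K where K: "K \<ge> 1" "\<And>n. norm (fps_nth V n) \<le> K * K ^ n"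
    using fps_nth_geometric_bound V unfolding has_fps_expansion_def by metis
  define W where "W = Abs_fps (\<lambda>n. of_real (m / (real n + m)) * fps_nth V n)"
  have "norm (fps_nth W n) \<le> K * K ^ n" for n
  proof -
    have "norm (fps_nth W n) = m / (real n + m) * norm (fps_nth V n)"
      using \<open>m > 0\<close> unfolding W_def fps_nth_Abs_fps norm_mult norm_of_real by simp
    also have "\<dots> \<le> 1 * (K * K ^ n)"
      using \<open>m > 0\<close> K by (intro mult_mono) auto
    finally show ?thesis by simp
  qed
  then have W: "eval_fps W has_fps_expansion W"
    using K(1) by (intro has_fps_expansion_eval_fps_self fps_conv_radius_posI)
  have eq: "fps_X * fps_deriv W + fps_const (of_real m) * W = fps_const (of_real m) * V"
  proof (rule fps_ext)
    fix n
    have "of_nat n + complex_of_real m = of_real (real n + m)" by simp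
    also have "\<dots> \<noteq> 0" using \<open>m > 0\<close> by (metis add_nonneg_pos less_irrefl of_nat_0_le_iff of_real_eq_0_iff)
    finally have "(of_nat n + complex_of_real m) * fps_nth W n = of_real m * fps_nth V n"
      by (simp add: W_def)
    moreover have "fps_nth (fps_X * fps_deriv W + fps_const (of_real m) * W) n
        = (of_nat n + complex_of_real m) * fps_nth W n"
      by (cases n) (simp_all add: algebra_simps)
    ultimately show "fps_nth (fps_X * fps_deriv W + fps_const (of_real m) * W) n
        = fps_nth (fps_const (of_real m) * V) n"
      by simp
  qed
  have "(\<lambda>s. s * deriv (eval_fps W) s + of_real m * eval_fps W s)
      has_fps_expansion fps_const (of_real m) * V"
    unfolding eq[symmetric]
    by (intro has_fps_expansion_add has_fps_expansion_mult has_fps_expansion_fps_X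
        has_fps_expansion_deriv has_fps_expansion_const W)
  moreover have "(\<lambda>s. of_real m * v s) has_fps_expansion fps_const (of_real m) * V"
    by (intro has_fps_expansion_mult has_fps_expansion_const V)
  ultimately have "\<forall>\<^sub>F s in nhds 0. s * deriv (eval_fps W) s + of_real m * eval_fps W s = of_real m * v s"
    by (rule has_fps_expansion_imp_eventually_eq)
  moreover have "eval_fps W 0 = v 0"
    using \<open>m > 0\<close> has_fps_expansion_imp_0_eq_fps_nth_0[OF V] by (simp add: eval_fps_at_0 W_def)
  ultimately show thesis using that has_fps_expansion_imp_analytic_0[OF W] by blast
qed

text \<open>Logarithms give a meaning to the powers with exponents \<open>1/2\<close> and
  \<open>1/m\<close> that the normalization of the order involves.\<close>

lemma analytic_log_exists:
  assumes "u analytic_on {0 :: complex}" "u 0 \<noteq> 0"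
  obtains L where "L analytic_on {0}" "\<forall>\<^sub>F s in nhds 0. u s = exp (L s)"
proof -
  obtain S where S: "open S" "0 \<in> S" "u holomorphic_on S" using assms by (auto simp: analytic_at)
  have "\<forall>\<^sub>F s in nhds 0. u s \<noteq> 0"
    by (rule analytic_eventually_nonzero[OF assms])
  then have "\<forall>\<^sub>F s in nhds 0. s \<in> S \<and> u s \<noteq> 0"
    using S by (intro eventually_conj eventually_nhds_in_open) auto
  then obtain r where r: "r > 0" "\<And>s. s \<in> ball 0 r \<Longrightarrow> s \<in> S \<and> u s \<noteq> 0"
    unfolding eventually_nhds_metric by (auto simp: dist_commute)
  have "u holomorphic_on ball 0 r" using r(2) by (intro holomorphic_on_subset[OF S(3)]) blast
  then obtain L where L: "L holomorphic_on ball 0 r" "\<And>s. s \<in> ball 0 r \<Longrightarrow> exp (L s) = u s"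
    using r holomorphic_logarithm_exists[of "ball 0 r" u 0] by auto
  have "L analytic_on {0}"
    unfolding analytic_at using r(1) L(1) by (intro exI[of _ "ball 0 r"]) simp
  moreover have "\<forall>\<^sub>F s in nhds 0. s \<in> ball 0 r"
    using r(1) by (intro eventually_nhds_in_open) auto
  then have "\<forall>\<^sub>F s in nhds 0. u s = exp (L s)"
    by eventually_elim (simp add: L(2))
  ultimately show thesis by (rule that)
qed

lemma analytic_primitive_exists:
  assumes "u analytic_on {0 :: complex}"
  obtains p where "p analytic_on {0}" "p 0 = 0" "\<forall>\<^sub>F s in nhds 0. deriv p s = u s"
proof -
  obtain S where S: "open S" "0 \<in> S" "u holomorphic_on S" using assms by (auto simp: analytic_at)
  obtain r where r: "r > 0" "ball 0 r \<subseteq> S" using S open_contains_ball by blast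
  obtain p where p: "\<And>s. s \<in> ball 0 r \<Longrightarrow> (p has_field_derivative u s) (at s within ball 0 r)"
    using holomorphic_convex_primitive'[of "ball 0 r" u] r S by (auto intro: holomorphic_on_subset)
  then have p': "(p has_field_derivative u s) (at s)" if "s \<in> ball 0 r" for s
    using that by (metis at_within_open open_ball)
  have "(\<lambda>s. p s - p 0) analytic_on {0}"
  proof (intro analytic_on_diff analytic_on_const)
    have "p holomorphic_on ball 0 r"
      unfolding holomorphic_on_def field_differentiable_def using p by blast
    then show "p analytic_on {0}" unfolding analytic_at using r(1) by (intro exI[of _ "ball 0 r"]) simp
  qed
  moreover have "\<forall>\<^sub>F s in nhds 0. deriv (\<lambda>s. p s - p 0) s = u s"
  proof (rule eventually_mono)
    show "\<forall>\<^sub>F s in nhds 0. s \<in> ball 0 r"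
      using r(1) by (intro eventually_nhds_in_open) auto
    show "deriv (\<lambda>s. p s - p 0) s = u s" if "s \<in> ball 0 r" for s
      by (rule DERIV_imp_deriv) (auto intro!: derivative_eq_intros p'[OF that])
  qed
  ultimately show thesis using that[of "\<lambda>s. p s - p 0"] by simp
qed

text \<open>The equation \<open>\<rho>'\<^sup>2 \<rho>\<^sup>r = g\<close> for \<open>g = s\<^sup>r u\<close> is separable. With \<open>m = (r + 2) / 2\<close>
  the function \<open>w\<close> given by \<open>\<rho>\<^sup>m = s\<^sup>m w\<close> solves the linear equation \<open>s w' + m w = m u\<^sup>1\<^sup>/\<^sup>2\<close>.\<close>

lemma analytic_order_normalization:
  assumes g: "g analytic_on {0 :: complex}" and r: "ord0 g = enat r"
  obtains a \<rho> where "a analytic_on {0}" "a 0 \<noteq> 0" "\<rho> analytic_on {0}" "\<rho> 0 = 0"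
    "\<forall>\<^sub>F s in nhds 0. deriv \<rho> s = 1 / (a s)\<^sup>2" "\<forall>\<^sub>F s in nhds 0. g s * a s ^ 4 = \<rho> s ^ r"
proof -
  define G where "G = fps_expansion g 0"
  have G: "g has_fps_expansion G"
    unfolding G_def using g by (rule analytic_at_imp_has_fps_expansion_0)
  have G0: "G \<noteq> 0" "subdegree G = r" using r by (auto simp: ord0_def G_def split: if_splits)
  \<comment> \<open>\<open>H\<close> is the expansion of the unit \<open>u\<close> in
    \<open>g = s^r u\<close>; its logarithm will be \<open>U\<close>.\<close>
  define H where "H = fps_shift r G"
  have GH: "G = fps_X ^ r * H" using subdegree_decompose[of G] G0 by (simp add: H_def mult.commute)
  have H0: "fps_nth H 0 \<noteq> 0" using G0 nth_subdegree_nonzero[of G] by (simp add: H_def)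
  have "fps_conv_radius H > 0" using G by (simp add: H_def has_fps_expansion_def)
  then have H: "eval_fps H has_fps_expansion H" by (rule has_fps_expansion_eval_fps_self)
  have "(\<lambda>s. s ^ r * eval_fps H s) has_fps_expansion G"
    unfolding GH by (intro has_fps_expansion_mult has_fps_expansion_power has_fps_expansion_fps_X H)
  then have gu: "\<forall>\<^sub>F s in nhds 0. g s = s ^ r * eval_fps H s"
    by (rule has_fps_expansion_imp_eventually_eq[OF G])
  obtain U where U: "U analytic_on {0}" "\<forall>\<^sub>F s in nhds 0. eval_fps H s = exp (U s)"
    using analytic_log_exists[OF has_fps_expansion_imp_analytic_0[OF H]] H0 by (auto simp: eval_fps_at_0)
  \<comment> \<open>A square root of the equation is
    \<open>\<rho>^(r/2) \<rho>' = s^(r/2) u^(1/2)\<close>. The left side integrates to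
    \<open>\<rho>^m / m\<close> with \<open>m = r/2 + 1\<close>.\<close>
  define m where "m = (real r + 2) / 2"
  have m: "m > 0" by (simp add: m_def)
  have "(\<lambda>s. exp (U s / 2)) analytic_on {0}" by (intro analytic_intros U) auto
  from analytic_euler_ode[OF this m] obtain w where w: "w analytic_on {0}" "w 0 = exp (U 0 / 2)"
    "\<forall>\<^sub>F s in nhds 0. s * deriv w s + of_real m * w s = of_real m * exp (U s / 2)" by blast
  obtain W where W: "W analytic_on {0}" "\<forall>\<^sub>F s in nhds 0. w s = exp (W s)"
    using analytic_log_exists[OF w(1)] w(2) by auto
  \<comment> \<open>This is \<open>\<rho> = s w^(1/m)\<close>. The equation for \<open>w\<close>
    gives \<open>\<rho>' = w^(1/m) u^(1/2) / w\<close>, so the exponent of \<open>a\<close> below is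
    minus one half of a logarithm of \<open>\<rho>'\<close>.\<close>
  define \<rho> where "\<rho> s = s * exp (W s / of_real m)" for s
  define a where "a s = exp (- (W s / of_real m + U s / 2 - W s) / 2)" for s
  have an: "\<rho> analytic_on {0}" "a analytic_on {0}"
    unfolding \<rho>_def a_def using m by (auto intro!: analytic_intros W U)
  obtain S where S: "open S" "0 \<in> S" "W holomorphic_on S" using W by (auto simp: analytic_at)
  have "\<forall>\<^sub>F s in nhds 0. \<forall>\<^sub>F x in nhds s. w x = exp (W x)"
    using W(2) by (simp add: eventually_eventually)
  then have "\<forall>\<^sub>F s in nhds 0. deriv \<rho> s = 1 / (a s)\<^sup>2"
    using w(3) W(2) eventually_nhds_in_open[OF S(1,2)]
  proof eventually_elim
    case (elim s)
    have dW: "(W has_field_derivative deriv W s) (at s)"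
      using S elim(4) by (blast intro: holomorphic_derivI)
    have "deriv w s = deriv (\<lambda>s. exp (W s)) s"
      using elim(1) by (intro deriv_cong_ev) auto
    also have "\<dots> = exp (W s) * deriv W s"
      by (rule DERIV_imp_deriv) (auto intro!: derivative_eq_intros dW)
    finally have "exp (W s) * (s * deriv W s + of_real m) = of_real m * exp (U s / 2)"
      using elim(2,3) by (simp add: algebra_simps)
    then have "1 + s * deriv W s / of_real m = exp (U s / 2) / exp (W s)"
      using m by (simp add: field_simps)
    moreover have "deriv \<rho> s = exp (W s / of_real m) * (1 + s * deriv W s / of_real m)"
      unfolding \<rho>_def
      by (rule DERIV_imp_deriv)
        (use m in \<open>auto intro!: derivative_eq_intros dW simp: field_simps\<close>)
    ultimately have d: "deriv \<rho> s = exp (W s / of_real m + U s / 2 - W s)"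
      by (simp add: exp_add exp_diff)
    have a2: "(a s)\<^sup>2 = exp (2 * (- (W s / of_real m + U s / 2 - W s) / 2))"
      unfolding a_def by (rule exp_double[symmetric])
    have "exp X = 1 / exp (2 * (- X / 2))" for X :: complex
    proof -
      have "2 * (- X / 2) = - X" by simp
      then show ?thesis by (simp only: exp_minus divide_inverse inverse_inverse_eq mult_1)
    qed
    then show ?case unfolding d a2 .
  qed
  moreover have "\<forall>\<^sub>F s in nhds 0. g s * a s ^ 4 = \<rho> s ^ r"
    using gu U(2)
  proof eventually_elim
    case (elim s)
    have a4: "a s ^ 4 = exp (of_nat 4 * (- (W s / of_real m + U s / 2 - W s) / 2))"
      unfolding a_def by (simp only: exp_of_nat_mult)
    \<comment> \<open>In the exponent of \<open>u a^4\<close> the terms with \<open>U\<close> cancel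
      and \<open>2 W - 2 W / m\<close> remains, which equals \<open>r W / m\<close> by this
      relation.\<close>
    have r_m: "complex_of_nat r = 2 * of_real m - 2"
      by (simp add: m_def field_simps)
    have eq: "U s + of_nat 4 * (- (W s / of_real m + U s / 2 - W s) / 2) = of_nat r * (W s / of_real m)"
      unfolding r_m using m by (simp add: field_simps)
    have "g s * a s ^ 4 = s ^ r * exp (of_nat r * (W s / of_real m))"
      unfolding eq[symmetric] exp_add a4 elim by simp
    then show ?case
      by (simp only: \<rho>_def power_mult_distrib exp_of_nat_mult)
  qed
  ultimately show thesis
    by (intro that[OF an(2) _ an(1)]) (simp_all add: a_def \<rho>_def)
qed


subsection \<open>Normalizing associated functions\<close>

lemma cdiff_M_along_axis:
  assumes "cdiff_M g (t + axis i w)"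
  shows "(\<lambda>w. g (t + axis i w)) field_differentiable (at w)"
proof -
  obtain d where "(g has_derivative (\<lambda>v. \<Sum>i\<in>UNIV. d $ i * v $ i)) (at (t + axis i w))"
    using assms by (auto simp: cdiff_M_def)
  from has_derivative_compose[OF has_derivative_axis this] show ?thesis
    unfolding field_differentiable_def has_field_derivative_def
    by (intro exI[of _ "d $ i"]) (simp add: axis_def if_distrib cong: if_cong)
qed

lemma analytic_along_axis:
  assumes "\<forall>\<^sub>F t in nhds 0. cdiff_M g t"
  shows "(\<lambda>w. g (axis i w)) analytic_on {0}"
proof -
  have "\<forall>\<^sub>F w in nhds 0. cdiff_M g (0 + axis i w)"
    by (rule eventually_compose_filterlim[OF assms filterlim_axis])
  then obtain S where S: "open S" "0 \<in> S" "\<And>w. w \<in> S \<Longrightarrow> cdiff_M g (0 + axis i w)"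
    unfolding eventually_nhds by blast
  have "(\<lambda>w. g (0 + axis i w)) holomorphic_on S"
    unfolding holomorphic_on_def
    using S(3) by (blast intro: field_differentiable_at_within cdiff_M_along_axis)
  then show ?thesis using S(1,2) by (auto simp: analytic_at)
qed

lemma eventually_nhds_0_line:
  assumes "\<forall>\<^sub>F p in nhds (0 :: 'a::{topological_space,zero} \<times> 'b::{topological_space,zero}). P p"
  shows "\<forall>\<^sub>F t in nhds 0. P (0, t)"
  using eventually_nhds_0_pair[OF assms] by eventually_elim (rule eventually_nhds_x_imp_x)

text \<open>Both orders of the variables occur, because the derivative in \<open>z\<close> is
  studied as a function of the axis parameter, and the derivative along the axis as a function of
  \<open>z\<close>.\<close>

lemma cdiff_CM_along_axis:
  assumes "cdiff_CM G (z, t + axis i w)"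
  shows "isCont (\<lambda>(w, z). G (z, t + axis i w)) (w, z)" "isCont (\<lambda>(z, w). G (z, t + axis i w)) (z, w)"
    "(\<lambda>z. G (z, t + axis i w)) field_differentiable (at z)"
    "(\<lambda>w. G (z, t + axis i w)) field_differentiable (at w)"
proof -
  have G: "isCont G (z, t + axis i w)" by (rule cdiff_CM_imp_isCont[OF assms])
  have ax: "isCont (\<lambda>w. t + axis i w) w"
    by (rule has_derivative_continuous[OF has_derivative_axis])
  have fst: "isCont fst q" and snd: "isCont snd q" for q :: "complex \<times> complex"
    by (auto intro: continuous_intros)
  have 1: "isCont (\<lambda>p. (snd p, t + axis i (fst p))) (w, z)"
    using ax by (intro isCont_Pair snd isCont_o2[OF fst]) simp
  show "isCont (\<lambda>(w, z). G (z, t + axis i w)) (w, z)"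
    using isCont_o2[OF 1, of G] G by (simp add: case_prod_unfold)
  have 2: "isCont (\<lambda>p. (fst p, t + axis i (snd p))) (z, w)"
    using ax by (intro isCont_Pair fst isCont_o2[OF snd]) simp
  show "isCont (\<lambda>(z, w). G (z, t + axis i w)) (z, w)"
    using isCont_o2[OF 2, of G] G by (simp add: case_prod_unfold)
  show "(\<lambda>z. G (z, t + axis i w)) field_differentiable (at z)"
    by (rule cdiff_CM_slice(2)[OF assms])
  show "(\<lambda>w. G (z, t + axis i w)) field_differentiable (at w)"
    using cdiff_M_along_axis[OF cdiff_CM_slice(1)[OF assms]] by simp
qed

lemma eventually_along_axis:
  fixes t :: "complex^2"
  assumes "\<forall>\<^sub>F p in nhds (z, t). P p"
  shows "\<forall>\<^sub>F q in nhds (0 :: complex, z). P (snd q, t + axis i (fst q))"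
    "\<forall>\<^sub>F q in nhds (z, 0 :: complex). P (fst q, t + axis i (snd q))"
proof -
  have "filterlim (\<lambda>q. (snd q, t + axis i (fst q))) (nhds z \<times>\<^sub>F nhds t) (nhds 0 \<times>\<^sub>F nhds z)"
    by (intro filterlim_Pair filterlim_snd filterlim_compose[where g = "\<lambda>w. t + axis i w", OF filterlim_axis filterlim_fst])
  with assms show "\<forall>\<^sub>F q in nhds (0 :: complex, z). P (snd q, t + axis i (fst q))"
    unfolding nhds_prod by (rule eventually_compose_filterlim)
  have "filterlim (\<lambda>q. (fst q, t + axis i (snd q))) (nhds z \<times>\<^sub>F nhds t) (nhds z \<times>\<^sub>F nhds 0)"
    by (intro filterlim_Pair filterlim_fst filterlim_compose[where g = "\<lambda>w. t + axis i w", OF filterlim_axis filterlim_snd])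
  with assms show "\<forall>\<^sub>F q in nhds (z, 0 :: complex). P (fst q, t + axis i (snd q))"
    unfolding nhds_prod by (rule eventually_compose_filterlim)
qed

text \<open>This makes the coefficient of \<open>z\<close> in a germ analytic, hence admissible as
  the coefficient of a linear differential equation.\<close>

lemma analytic_deriv_z:
  assumes "\<forall>\<^sub>F p in nhds (0, t). cdiff_CM G p"
  shows "(\<lambda>w. deriv (\<lambda>z. G (z, t + axis i w)) 0) analytic_on {0}"
proof (rule analytic_deriv_second)
  show "\<forall>\<^sub>F p in nhds (0, 0). isCont (\<lambda>(w, z). G (z, t + axis i w)) p \<and>
      (\<lambda>z. G (z, t + axis i (fst p))) field_differentiable (at (snd p)) \<and>
      (\<lambda>w. G (snd p, t + axis i w)) field_differentiable (at (fst p))"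
    using eventually_along_axis(1)[OF assms]
    by eventually_elim (auto dest: cdiff_CM_along_axis)
qed

text \<open>The term \<open>z \<partial>_i T\<close> of the isomorphism equation is to be
  differentiated at \<open>z = 0\<close> by the product rule, which requires its second factor to be
  differentiable in \<open>z\<close>.\<close>

lemma analytic_pd:
  assumes "\<forall>\<^sub>F p in nhds (z, t). cdiff_CM G p"
  shows "(\<lambda>z. pd i (\<lambda>s. G (z, s)) t) analytic_on {z}"
  unfolding pd_def
proof (rule analytic_deriv_second)
  show "\<forall>\<^sub>F p in nhds (z, 0). isCont (\<lambda>(z, w). G (z, t + axis i w)) p \<and>
      (\<lambda>w. G (fst p, t + axis i w)) field_differentiable (at (snd p)) \<and>
      (\<lambda>z. G (z, t + axis i (snd p))) field_differentiable (at (fst p))"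
    using eventually_along_axis(2)[OF assms]
    by eventually_elim (auto dest: cdiff_CM_along_axis)
qed

section \<open>The coefficients \<open>f(0)\<close> and \<open>f(1)\<close> as analytic
  germs\<close>

lemma zcoeff_0: "zcoeff f 0 s = f s 0"
  by (simp add: zcoeff_def fps_expansion_def)

lemma zcoeff_1: "zcoeff f 1 s = deriv (f s) 0"
  by (simp add: zcoeff_def fps_expansion_def)

lemma germ_t2z_analytic_zcoeff:
  assumes "germ_t2z f"
  shows "(\<lambda>s. zcoeff f 0 s) analytic_on {0}" "(\<lambda>s. zcoeff f 1 s) analytic_on {0}"
proof -
  have ev: "\<forall>\<^sub>F p in nhds 0. cdiff_CM (\<lambda>p. f (snd p $ 2) (fst p)) p"
    using assms by (simp add: germ_t2z_iff)
  have "\<forall>\<^sub>F t in nhds 0. cdiff_M (\<lambda>s. f (s $ 2) 0) t"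
    using eventually_nhds_0_line[OF ev] by eventually_elim (auto dest: cdiff_CM_slice)
  from analytic_along_axis[OF this, of 2] show "(\<lambda>s. zcoeff f 0 s) analytic_on {0}"
    by (simp add: zcoeff_0)
  have "\<forall>\<^sub>F p in nhds (0, 0). cdiff_CM (\<lambda>p. f (snd p $ 2) (fst p)) p"
    using ev by (simp add: zero_prod_def)
  from analytic_deriv_z[OF this, of 2] show "(\<lambda>s. zcoeff f 1 s) analytic_on {0}"
    unfolding zcoeff_1 by simp
qed

lemma germ_t2z_field_differentiable_z:
  assumes "germ_t2z f"
  shows "\<forall>\<^sub>F s in nhds 0. f s field_differentiable (at 0)"
proof -
  have "\<forall>\<^sub>F p in nhds 0. cdiff_CM (\<lambda>p. f (snd p $ 2) (fst p)) p"
    using assms by (simp add: germ_t2z_iff)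
  from eventually_nhds_0_line[OF this]
  have "\<forall>\<^sub>F t in nhds (0 :: complex^2). f (t $ 2) field_differentiable (at 0)"
    by eventually_elim (auto dest: cdiff_CM_slice)
  then have "\<forall>\<^sub>F w in nhds 0. f ((0 + axis 2 w :: complex^2) $ 2) field_differentiable (at 0)"
    by (rule eventually_compose_filterlim[OF _ filterlim_axis])
  then show ?thesis by simp
qed

lemma associated_trans:
  assumes "associated g A" "germ_t2z f" "hol_isomorphic (normal_form g) (normal_form f)"
  shows "associated f A"
  using assms hol_isomorphic_trans unfolding associated_def by blast

lemma analytic_nhds_filterlim:
  assumes "\<mu> analytic_on {0 :: complex}" "\<mu> 0 = 0"
  shows "filterlim \<mu> (nhds 0) (nhds 0)"
  using analytic_at_imp_isCont[OF assms(1)] assms(2) tendsto_at_iff_tendsto_nhds[of \<mu> 0]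
  by (simp add: isCont_def)

text \<open>The change of variable multiplies \<open>g(0)\<close> by a unit, so its vanishing
  persists, and replaces \<open>g(1)\<close> by \<open>(g(1) - a''/a) a^4\<close>, evaluated at
  \<open>\<mu>\<close>. The second expression vanishes when \<open>a'' = g(1) a\<close>.\<close>

lemma associated_vanishing:
  assumes g: "associated g A" and g0: "\<forall>\<^sub>F s in nhds 0. zcoeff g 0 s = 0"
  obtains f where "associated f A" "\<forall>\<^sub>F s in nhds 0. zcoeff f 0 s = 0"
    "\<forall>\<^sub>F s in nhds 0. zcoeff f 1 s = 0"
proof -
  have gg: "germ_t2z g" using g by (simp add: associated_def)
  obtain a where a: "a analytic_on {0}" "a 0 = 1"
    "\<forall>\<^sub>F s in nhds 0. deriv (deriv a) s = zcoeff g 1 s * a s"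
    using analytic_second_order_ode[OF germ_t2z_analytic_zcoeff(2)[OF gg]] by blast
  have a0: "a 0 \<noteq> 0" by (simp add: a(2))
  have "(\<lambda>s. 1 / (a s)\<^sup>2) analytic_on {0}"
    by (intro analytic_intros a) (simp add: a(2))
  then obtain \<rho> where \<rho>: "\<rho> analytic_on {0}" "\<rho> 0 = 0"
    "\<forall>\<^sub>F s in nhds 0. deriv \<rho> s = 1 / (a s)\<^sup>2"
    using analytic_primitive_exists by blast
  obtain f \<mu> where f: "germ_t2z f" "hol_isomorphic (normal_form g) (normal_form f)"
    and \<mu>: "\<mu> analytic_on {0}" "\<mu> 0 = 0" "\<forall>\<^sub>F s in nhds 0. \<rho> (\<mu> s) = s"
    and f_eq: "\<And>s z. f s z = (g (\<mu> s) z - z * deriv (deriv a) (\<mu> s) / a (\<mu> s)) * a (\<mu> s) ^ 4"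
    by (rule normal_form_change_of_variable[OF gg a(1) a0 \<rho>]) (rule that)
  note \<mu>_lim = analytic_nhds_filterlim[OF \<mu>(1,2)]
  have "\<forall>\<^sub>F s in nhds 0. zcoeff f 0 s = 0"
    using eventually_compose_filterlim[OF g0 \<mu>_lim]
    by eventually_elim (simp add: zcoeff_0 f_eq)
  moreover have "\<forall>\<^sub>F s in nhds 0. a s \<noteq> 0"
    by (rule analytic_eventually_nonzero[OF a(1) a0])
  then have "\<forall>\<^sub>F s in nhds 0. deriv (deriv a) s = zcoeff g 1 s * a s \<and> a s \<noteq> 0 \<and>
      g s field_differentiable (at 0)"
    using a(3) germ_t2z_field_differentiable_z[OF gg] by eventually_elim simp
  from eventually_compose_filterlim[OF this \<mu>_lim] have "\<forall>\<^sub>F s in nhds 0. zcoeff f 1 s = 0"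
  proof eventually_elim
    case (elim s)
    \<comment> \<open>The coefficient \<open>zcoeff g 1\<close> is a value of \<open>deriv\<close>,
      which is a true derivative only because \<open>g (\<mu> s)\<close> is differentiable at
      0.\<close>
    have "(g (\<mu> s) has_field_derivative zcoeff g 1 (\<mu> s)) (at 0)"
      unfolding zcoeff_1 using elim by (simp add: field_differentiable_derivI)
    then have "((\<lambda>z. (g (\<mu> s) z - z * deriv (deriv a) (\<mu> s) / a (\<mu> s)) * a (\<mu> s) ^ 4)
        has_field_derivative 0) (at 0)"
      using elim by (auto intro!: derivative_eq_intros)
    then have "(f s has_field_derivative 0) (at 0)" by (simp add: f_eq[abs_def])
    then show ?case unfolding zcoeff_1 by (rule DERIV_imp_deriv)
  qed
  ultimately show thesis using that associated_trans[OF g f] by blast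
qed

text \<open>At \<open>z = 0\<close> the new function is \<open>g(0) a^4\<close> evaluated at
  \<open>\<mu>\<close>, that is \<open>\<rho>(\<mu>(s))^r = s^r\<close>.\<close>

lemma associated_monomial:
  assumes g: "associated g A" and r: "ord0 (zcoeff g 0) = enat r"
  obtains f where "associated f A" "\<forall>\<^sub>F s in nhds 0. zcoeff f 0 s = s ^ r"
proof -
  have gg: "germ_t2z g" using g by (simp add: associated_def)
  obtain a \<rho> where a: "a analytic_on {0}" "a 0 \<noteq> 0" and \<rho>: "\<rho> analytic_on {0}" "\<rho> 0 = 0"
    "\<forall>\<^sub>F s in nhds 0. deriv \<rho> s = 1 / (a s)\<^sup>2"
    and eq: "\<forall>\<^sub>F s in nhds 0. zcoeff g 0 s * a s ^ 4 = \<rho> s ^ r"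
    using analytic_order_normalization[OF germ_t2z_analytic_zcoeff(1)[OF gg] r] by blast
  obtain f \<mu> where f: "germ_t2z f" "hol_isomorphic (normal_form g) (normal_form f)"
    and \<mu>: "\<mu> analytic_on {0}" "\<mu> 0 = 0" "\<forall>\<^sub>F s in nhds 0. \<rho> (\<mu> s) = s"
    and f_eq: "\<And>s z. f s z = (g (\<mu> s) z - z * deriv (deriv a) (\<mu> s) / a (\<mu> s)) * a (\<mu> s) ^ 4"
    by (rule normal_form_change_of_variable[OF gg a \<rho>]) (rule that)
  have "\<forall>\<^sub>F s in nhds 0. zcoeff f 0 s = s ^ r"
    using eventually_compose_filterlim[OF eq analytic_nhds_filterlim[OF \<mu>(1,2)]] \<mu>(3)
    by eventually_elim (simp add: zcoeff_0 f_eq)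
  then show thesis using that associated_trans[OF g f] by blast
qed


subsection \<open>First-order jets of isomorphisms\<close>

definition zlin :: "(complex \<times> (complex^2) \<Rightarrow> complex^2^2) \<Rightarrow> complex^2 \<Rightarrow> complex^2^2" where
  "zlin G t = (\<chi> a b. deriv (\<lambda>z. G (z, t) $ a $ b) 0)"

text \<open>The coefficients of \<open>z^0\<close> and \<open>z^1\<close> in the isomorphism
  equation for \<open>T = X + z Y + ...\<close>, a notion shared by formal and convergent
  isomorphisms. The derivative of \<open>T\<close> carries a factor \<open>z\<close>, so at this
  order only \<open>X\<close> is differentiated and \<open>Y\<close> enters by its values.\<close>

definition jet_isomorphism ::
  "matrix_pair \<Rightarrow> matrix_pair \<Rightarrow> (complex^2 \<Rightarrow> complex^2) \<Rightarrow>
   (complex^2 \<Rightarrow> complex^2^2) \<Rightarrow> (complex^2 \<Rightarrow> complex^2^2) \<Rightarrow> bool" where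
  "jet_isomorphism A' A h X Y \<longleftrightarrow>
     biholomorphic_germ h \<and>
     (\<forall>\<^sub>F t in nhds 0. \<forall>a b. cdiff_M (\<lambda>s. X s $ a $ b) t) \<and>
     (\<forall>\<^sub>F t in nhds 0. invertible (X t)) \<and>
     (\<forall>\<^sub>F t in nhds 0. \<forall>i.
        (\<Sum>j\<in>UNIV. mat (pd i (\<lambda>s. h s $ j) t) ** A j (0, h t)) ** X t - X t ** A' i (0, t) = 0) \<and>
     (\<forall>\<^sub>F t in nhds 0. \<forall>i.
        pd_mat i X t + (\<Sum>j\<in>UNIV. mat (pd i (\<lambda>s. h s $ j) t) ** zlin (A j) (h t)) ** X t
        + (\<Sum>j\<in>UNIV. mat (pd i (\<lambda>s. h s $ j) t) ** A j (0, h t)) ** Y t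
        - X t ** zlin (A' i) t - Y t ** A' i (0, t) = 0)"

lemma z_expansion_nth_0: "fps_nth (z_expansion G t $ a $ b) 0 = G (0, t) $ a $ b"
  by (simp add: z_expansion_def fps_expansion_def)

lemma z_expansion_nth_1: "fps_nth (z_expansion G t $ a $ b) (Suc 0) = zlin G t $ a $ b"
  by (simp add: z_expansion_def fps_expansion_def zlin_def)

lemma jet_isomorphism_formal:
  assumes "formal_isomorphism A' A h T"
  shows "jet_isomorphism A' A h (\<lambda>t. \<chi> a b. fps_nth (T t $ a $ b) 0) (\<lambda>t. \<chi> a b. fps_nth (T t $ a $ b) 1)"
proof -
  let ?E = "\<lambda>i t. mat fps_X ** pd_fps_mat i T t
    + (\<Sum>j\<in>UNIV. mat (fps_const (pd i (\<lambda>s. h s $ j) t)) ** z_expansion (A j) (h t)) ** T t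
    - T t ** z_expansion (A' i) t"
  have T: "\<And>a b. germ_t_formal_z (\<lambda>t. T t $ a $ b)" and bh: "biholomorphic_germ h"
    and inv: "\<forall>\<^sub>F t in nhds 0. invertible (\<chi> a b. fps_nth (T t $ a $ b) 0)"
    and eq: "\<And>i. \<forall>\<^sub>F t in nhds 0. ?E i t = 0"
    using assms unfolding formal_isomorphism_def by blast+
  have eq_all: "\<forall>\<^sub>F t in nhds 0. \<forall>i. ?E i t = 0"
    using eq by (intro eventually_all_finite)
  have cd: "\<forall>\<^sub>F t in nhds 0. cdiff_M (\<lambda>s. fps_nth (T s $ a $ b) 0) t" for a b
    using T[of a b] unfolding germ_t_formal_z_def holM_on_iff eventually_nhds by blast
  show ?thesis
    unfolding jet_isomorphism_def
  proof (intro conjI bh inv)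
    show "\<forall>\<^sub>F t in nhds 0. \<forall>a b. cdiff_M (\<lambda>s. (\<chi> a b. fps_nth (T s $ a $ b) 0) $ a $ b) t"
      using cd by (intro eventually_all_finite) simp
    show "\<forall>\<^sub>F t in nhds 0. \<forall>i.
        (\<Sum>j\<in>UNIV. mat (pd i (\<lambda>s. h s $ j) t) ** A j (0, h t)) ** (\<chi> a b. fps_nth (T t $ a $ b) 0)
        - (\<chi> a b. fps_nth (T t $ a $ b) 0) ** A' i (0, t) = 0"
      using eq_all
    proof eventually_elim
      case (elim t)
      show ?case
      proof
        fix i
        have "\<forall>a b. fps_nth (?E i t $ a $ b) 0 = 0" using elim by simp
        then show "(\<Sum>j\<in>UNIV. mat (pd i (\<lambda>s. h s $ j) t) ** A j (0, h t)) ** (\<chi> a b. fps_nth (T t $ a $ b) 0)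
          - (\<chi> a b. fps_nth (T t $ a $ b) 0) ** A' i (0, t) = 0"
          by (simp add: vec_eq_iff forall_2 matrix_matrix_mult_def mat_def sum_2 z_expansion_nth_0)
      qed
    qed
    show "\<forall>\<^sub>F t in nhds 0. \<forall>i. pd_mat i (\<lambda>t. \<chi> a b. fps_nth (T t $ a $ b) 0) t
        + (\<Sum>j\<in>UNIV. mat (pd i (\<lambda>s. h s $ j) t) ** zlin (A j) (h t)) ** (\<chi> a b. fps_nth (T t $ a $ b) 0)
        + (\<Sum>j\<in>UNIV. mat (pd i (\<lambda>s. h s $ j) t) ** A j (0, h t)) ** (\<chi> a b. fps_nth (T t $ a $ b) 1)
        - (\<chi> a b. fps_nth (T t $ a $ b) 0) ** zlin (A' i) t
        - (\<chi> a b. fps_nth (T t $ a $ b) 1) ** A' i (0, t) = 0"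
      using eq_all
    proof eventually_elim
      case (elim t)
      show ?case
      proof
        fix i
        \<comment> \<open>Multiplication by \<open>fps_X\<close> shifts the derivative term, so this
          coefficient contains the derivative of the constant term of \<open>T\<close>.\<close>
        have "\<forall>a b. fps_nth (?E i t $ a $ b) (Suc 0) = 0" using elim by simp
        then show "pd_mat i (\<lambda>t. \<chi> a b. fps_nth (T t $ a $ b) 0) t
          + (\<Sum>j\<in>UNIV. mat (pd i (\<lambda>s. h s $ j) t) ** zlin (A j) (h t)) ** (\<chi> a b. fps_nth (T t $ a $ b) 0)
          + (\<Sum>j\<in>UNIV. mat (pd i (\<lambda>s. h s $ j) t) ** A j (0, h t)) ** (\<chi> a b. fps_nth (T t $ a $ b) 1)
          - (\<chi> a b. fps_nth (T t $ a $ b) 0) ** zlin (A' i) t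
          - (\<chi> a b. fps_nth (T t $ a $ b) 1) ** A' i (0, t) = 0"
          by (simp add: vec_eq_iff forall_2 matrix_matrix_mult_def mat_def sum_2 z_expansion_nth_0
              z_expansion_nth_1 fps_mult_nth_1 pd_mat_def pd_fps_mat_def algebra_simps)
      qed
    qed
  qed
qed

lemma zlin_has_field_derivative:
  assumes "cdiff_CM (\<lambda>p. G p $ a $ b) (0, t)"
  shows "((\<lambda>z. G (z, t) $ a $ b) has_field_derivative zlin G t $ a $ b) (at 0)"
  using cdiff_CM_slice(2)[OF assms] by (simp add: zlin_def field_differentiable_derivI)

lemma eventually_cdiff_CM_matrix:
  fixes G :: "complex \<times> (complex^2) \<Rightarrow> complex^2^2"
  assumes "\<And>a b. germ_tz (\<lambda>p. G p $ a $ b)"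
  shows "\<forall>\<^sub>F p in nhds 0. \<forall>a b. cdiff_CM (\<lambda>p. G p $ a $ b) p"
  using assms unfolding germ_tz_iff by (intro eventually_all_finite)

text \<open>For fixed small \<open>t\<close> the equation holds for all \<open>z\<close> near 0. Its
  value and its derivative at \<open>z = 0\<close> are the two jet equations.\<close>

lemma jet_isomorphism_hol:
  assumes "hol_isomorphism A' A h T"
    and A': "\<And>i a b. germ_tz (\<lambda>p. A' i p $ a $ b)" and A: "\<And>i a b. germ_tz (\<lambda>p. A i p $ a $ b)"
  shows "jet_isomorphism A' A h (\<lambda>t. T (0, t)) (zlin T)"
proof -
  let ?E = "\<lambda>i z t. mat z ** pd_mat i (\<lambda>s. T (z, s)) t
    + (\<Sum>j\<in>UNIV. mat (pd i (\<lambda>s. h s $ j) t) ** A j (z, h t)) ** T (z, t) - T (z, t) ** A' i (z, t)"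
  have T: "\<And>a b. germ_tz (\<lambda>p. T p $ a $ b)" and bh: "biholomorphic_germ h"
    and inv: "\<forall>\<^sub>F t in nhds 0. invertible (T (0, t))"
    and eq: "\<And>i. \<forall>\<^sub>F p in nhds 0. ?E i (fst p) (snd p) = 0"
    using assms(1) unfolding hol_isomorphism_def case_prod_unfold by blast+
  have "\<forall>\<^sub>F p in nhds 0. \<forall>i. ?E i (fst p) (snd p) = 0"
    using eq by (intro eventually_all_finite)
  from eventually_nhds_0_pair[OF this]
  have eq': "\<forall>\<^sub>F t in nhds 0. \<forall>\<^sub>F z in nhds 0. \<forall>i. ?E i z t = 0" by simp
  have cA': "\<forall>\<^sub>F t in nhds 0. \<forall>i a b. cdiff_CM (\<lambda>p. A' i p $ a $ b) (0, t)"
    using A' by (intro eventually_nhds_0_line eventually_all_finite) (simp add: germ_tz_iff)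
  have "\<forall>\<^sub>F t in nhds 0. \<forall>i a b. cdiff_CM (\<lambda>p. A i p $ a $ b) (0, t)"
    using A by (intro eventually_nhds_0_line eventually_all_finite) (simp add: germ_tz_iff)
  from eventually_compose_filterlim[OF this biholomorphic_germ_filterlim[OF bh]]
  have cA: "\<forall>\<^sub>F t in nhds 0. \<forall>i a b. cdiff_CM (\<lambda>p. A i p $ a $ b) (0, h t)" .
  have "\<forall>\<^sub>F p in nhds 0. \<forall>\<^sub>F q in nhds p. \<forall>a b. cdiff_CM (\<lambda>p. T p $ a $ b) q"
    using eventually_cdiff_CM_matrix[OF T] by (simp add: eventually_eventually)
  from eventually_nhds_0_line[OF this]
  have cT: "\<forall>\<^sub>F t in nhds 0. \<forall>\<^sub>F q in nhds (0, t). \<forall>a b. cdiff_CM (\<lambda>p. T p $ a $ b) q" .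
  show ?thesis
    unfolding jet_isomorphism_def
  proof (intro conjI bh inv)
    show "\<forall>\<^sub>F t in nhds 0. \<forall>a b. cdiff_M (\<lambda>s. T (0, s) $ a $ b) t"
      using cT
    proof eventually_elim
      case (elim t)
      then show ?case
        using cdiff_CM_slice(1)[of "\<lambda>p. T p $ _ $ _"] eventually_nhds_x_imp_x by blast
    qed
    show "\<forall>\<^sub>F t in nhds 0. \<forall>i. (\<Sum>j\<in>UNIV. mat (pd i (\<lambda>s. h s $ j) t) ** A j (0, h t)) ** T (0, t)
        - T (0, t) ** A' i (0, t) = 0"
      using eq' by eventually_elim (auto dest!: eventually_nhds_x_imp_x)
    show "\<forall>\<^sub>F t in nhds 0. \<forall>i. pd_mat i (\<lambda>t. T (0, t)) t
        + (\<Sum>j\<in>UNIV. mat (pd i (\<lambda>s. h s $ j) t) ** zlin (A j) (h t)) ** T (0, t)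
        + (\<Sum>j\<in>UNIV. mat (pd i (\<lambda>s. h s $ j) t) ** A j (0, h t)) ** zlin T t
        - T (0, t) ** zlin (A' i) t - zlin T t ** A' i (0, t) = 0"
      using eq' cA' cA cT
    proof eventually_elim
      case (elim t)
      show ?case
      proof
        fix i
        have dA': "((\<lambda>z. A' i (z, t) $ a $ b) has_field_derivative zlin (A' i) t $ a $ b) (at 0)" for a b
          using elim(2) by (intro zlin_has_field_derivative) simp
        have dA: "((\<lambda>z. A j (z, h t) $ a $ b) has_field_derivative zlin (A j) (h t) $ a $ b) (at 0)" for j a b
          using elim(3) by (intro zlin_has_field_derivative) simp
        have dT: "((\<lambda>z. T (z, t) $ a $ b) has_field_derivative zlin T t $ a $ b) (at 0)" for a b
          using eventually_nhds_x_imp_x[OF elim(4)] by (intro zlin_has_field_derivative) simp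
        have "(\<lambda>z. pd i (\<lambda>s. T (z, s) $ a $ b) t) analytic_on {0}" for a b
          using elim(4) by (intro analytic_pd) (auto elim: eventually_mono)
        then have dpd: "\<exists>D. ((\<lambda>z. pd i (\<lambda>s. T (z, s) $ a $ b) t) has_field_derivative D) (at 0)" for a b
          using analytic_on_imp_differentiable_at[of _ "{0}" 0] by (simp add: field_differentiable_def)
        have "(pd_mat i (\<lambda>t. T (0, t)) t
          + (\<Sum>j\<in>UNIV. mat (pd i (\<lambda>s. h s $ j) t) ** zlin (A j) (h t)) ** T (0, t)
          + (\<Sum>j\<in>UNIV. mat (pd i (\<lambda>s. h s $ j) t) ** A j (0, h t)) ** zlin T t
          - T (0, t) ** zlin (A' i) t - zlin T t ** A' i (0, t)) $ a $ b = 0" (is "?R $ a $ b = 0") for a b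
        proof -
          obtain D where D: "((\<lambda>z. pd i (\<lambda>s. T (z, s) $ a $ b) t) has_field_derivative D) (at 0)"
            using dpd by blast
          \<comment> \<open>The derivative \<open>D\<close> of the partial derivative of
            \<open>T\<close> enters with the factor \<open>z = 0\<close>, so its value is immaterial
            and only its existence is used.\<close>
          have 1: "((\<lambda>z. z * pd i (\<lambda>s. T (z, s) $ a $ b) t
              + (\<Sum>k\<in>UNIV. (\<Sum>j\<in>UNIV. pd i (\<lambda>s. h s $ j) t * A j (z, h t) $ a $ k) * T (z, t) $ k $ b)
              - (\<Sum>k\<in>UNIV. T (z, t) $ a $ k * A' i (z, t) $ k $ b)) has_field_derivative ?R $ a $ b) (at 0)"
            unfolding sum_2
            by (rule derivative_eq_intros D dT dA dA' refl)+
              (use exhaust_2[of a] in \<open>auto simp: pd_mat_def matrix_matrix_mult_def mat_def sum_2 algebra_simps\<close>)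
          have 2: "\<forall>\<^sub>F z in nhds 0. z * pd i (\<lambda>s. T (z, s) $ a $ b) t
              + (\<Sum>k\<in>UNIV. (\<Sum>j\<in>UNIV. pd i (\<lambda>s. h s $ j) t * A j (z, h t) $ a $ k) * T (z, t) $ k $ b)
              - (\<Sum>k\<in>UNIV. T (z, t) $ a $ k * A' i (z, t) $ k $ b) = 0"
            using elim(1)
          proof eventually_elim
            case (elim z)
            then have "?E i z t $ a $ b = 0" by simp
            then show ?case using exhaust_2[of a]
              by (auto simp: pd_mat_def matrix_matrix_mult_def mat_def sum_2)
          qed
          show ?thesis
            by (rule DERIV_unique[OF iffD1[OF DERIV_cong_ev[OF refl 2 refl] 1] DERIV_const])
        qed
        then show "?R = 0" by (simp add: vec_eq_iff)
      qed
    qed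
  qed
qed

text \<open>The expansion of the gauge composition to first order in \<open>z\<close>, for the
  product \<open>(X2 + z Y2)(X + z Y)\<close>. In the linear term each equation of one factor is
  paired with both coefficients of the other.\<close>

lemma jet_gauge_compose_identity:
  fixes X Y X2 Y2 D1 A0 A1 :: "complex^2^2" and B0 B1 C0 C1 D :: "2 \<Rightarrow> complex^2^2"
    and p :: "2 \<Rightarrow> complex" and k :: "2 \<Rightarrow> 2 \<Rightarrow> complex"
  assumes F0: "(\<Sum>j\<in>UNIV. mat (p j) ** B0 j) ** X - X ** A0 = 0"
    and F1: "D1 + (\<Sum>j\<in>UNIV. mat (p j) ** B1 j) ** X + (\<Sum>j\<in>UNIV. mat (p j) ** B0 j) ** Y
      - X ** A1 - Y ** A0 = 0"
    and E0: "\<And>j. (\<Sum>l\<in>UNIV. mat (k l j) ** C0 l) ** X2 - X2 ** B0 j = 0"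
    and E1: "\<And>j. D j + (\<Sum>l\<in>UNIV. mat (k l j) ** C1 l) ** X2 + (\<Sum>l\<in>UNIV. mat (k l j) ** C0 l) ** Y2
      - X2 ** B1 j - Y2 ** B0 j = 0"
  shows "(\<Sum>l\<in>UNIV. mat (\<Sum>j\<in>UNIV. p j * k l j) ** C0 l) ** (X2 ** X) - (X2 ** X) ** A0 = 0"
    "((\<Sum>j\<in>UNIV. mat (p j) ** D j) ** X + X2 ** D1)
      + (\<Sum>l\<in>UNIV. mat (\<Sum>j\<in>UNIV. p j * k l j) ** C1 l) ** (X2 ** X)
      + (\<Sum>l\<in>UNIV. mat (\<Sum>j\<in>UNIV. p j * k l j) ** C0 l) ** (X2 ** Y + Y2 ** X)
      - (X2 ** X) ** A1 - (X2 ** Y + Y2 ** X) ** A0 = 0"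
proof -
  let ?F0 = "(\<Sum>j\<in>UNIV. mat (p j) ** B0 j) ** X - X ** A0"
  let ?F1 = "D1 + (\<Sum>j\<in>UNIV. mat (p j) ** B1 j) ** X + (\<Sum>j\<in>UNIV. mat (p j) ** B0 j) ** Y
      - X ** A1 - Y ** A0"
  let ?E0 = "\<lambda>j. (\<Sum>l\<in>UNIV. mat (k l j) ** C0 l) ** X2 - X2 ** B0 j"
  let ?E1 = "\<lambda>j. D j + (\<Sum>l\<in>UNIV. mat (k l j) ** C1 l) ** X2 + (\<Sum>l\<in>UNIV. mat (k l j) ** C0 l) ** Y2
      - X2 ** B1 j - Y2 ** B0 j"
  have "(\<Sum>l\<in>UNIV. mat (\<Sum>j\<in>UNIV. p j * k l j) ** C0 l) ** (X2 ** X) - (X2 ** X) ** A0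
    = (\<Sum>j\<in>UNIV. mat (p j) ** ?E0 j) ** X + X2 ** ?F0"
    by (simp add: vec_eq_iff forall_2 matrix_matrix_mult_def mat_def sum_2 algebra_simps)
  then show "(\<Sum>l\<in>UNIV. mat (\<Sum>j\<in>UNIV. p j * k l j) ** C0 l) ** (X2 ** X) - (X2 ** X) ** A0 = 0"
    by (simp only: E0 F0) simp
  have "((\<Sum>j\<in>UNIV. mat (p j) ** D j) ** X + X2 ** D1)
      + (\<Sum>l\<in>UNIV. mat (\<Sum>j\<in>UNIV. p j * k l j) ** C1 l) ** (X2 ** X)
      + (\<Sum>l\<in>UNIV. mat (\<Sum>j\<in>UNIV. p j * k l j) ** C0 l) ** (X2 ** Y + Y2 ** X)
      - (X2 ** X) ** A1 - (X2 ** Y + Y2 ** X) ** A0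
    = (\<Sum>j\<in>UNIV. mat (p j) ** ?E1 j) ** X + (\<Sum>j\<in>UNIV. mat (p j) ** ?E0 j) ** Y + X2 ** ?F1 + Y2 ** ?F0"
    by (simp add: vec_eq_iff forall_2 matrix_matrix_mult_def mat_def sum_2 algebra_simps)
  then show "((\<Sum>j\<in>UNIV. mat (p j) ** D j) ** X + X2 ** D1)
      + (\<Sum>l\<in>UNIV. mat (\<Sum>j\<in>UNIV. p j * k l j) ** C1 l) ** (X2 ** X)
      + (\<Sum>l\<in>UNIV. mat (\<Sum>j\<in>UNIV. p j * k l j) ** C0 l) ** (X2 ** Y + Y2 ** X)
      - (X2 ** X) ** A1 - (X2 ** Y + Y2 ** X) ** A0 = 0"
    by (simp only: E0 E1 F0 F1) simp
qed

text \<open>This is where a formal isomorphism can be followed by a convergent one: after truncation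
  both are of the same kind.\<close>

lemma jet_isomorphism_compose:
  assumes "jet_isomorphism A B h X Y" "jet_isomorphism B C k X2 Y2"
  shows "jet_isomorphism A C (\<lambda>t. k (h t)) (\<lambda>t. X2 (h t) ** X t)
    (\<lambda>t. X2 (h t) ** Y t + Y2 (h t) ** X t)"
proof -
  have h: "biholomorphic_germ h" and k: "biholomorphic_germ k"
    and X: "\<forall>\<^sub>F t in nhds 0. \<forall>a b. cdiff_M (\<lambda>s. X s $ a $ b) t"
    and X2: "\<forall>\<^sub>F t in nhds 0. \<forall>a b. cdiff_M (\<lambda>s. X2 s $ a $ b) t"
    and invX: "\<forall>\<^sub>F t in nhds 0. invertible (X t)" and invX2: "\<forall>\<^sub>F t in nhds 0. invertible (X2 t)"
    using assms unfolding jet_isomorphism_def by blast+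
  note F = assms(1)[unfolded jet_isomorphism_def, THEN conjunct2, THEN conjunct2, THEN conjunct2]
  note G = assms(2)[unfolded jet_isomorphism_def, THEN conjunct2, THEN conjunct2, THEN conjunct2]
  note lim = biholomorphic_germ_filterlim[OF h]
  note G0 = eventually_compose_filterlim[OF G[THEN conjunct1] lim]
  note G1 = eventually_compose_filterlim[OF G[THEN conjunct2] lim]
  note hc = biholomorphic_germ_cdiff[OF h]
    and kc = eventually_compose_filterlim[OF biholomorphic_germ_cdiff[OF k] lim]
  note X2h = eventually_compose_filterlim[OF X2 lim]
  have dk: "pd i (\<lambda>s. k (h s) $ l) t =
      (\<Sum>j\<in>UNIV. pd i (\<lambda>s. h s $ j) t * pd j (\<lambda>s. k s $ l) (h t))"
    if "\<forall>j. cdiff_M (\<lambda>s. h s $ j) t" "\<forall>j. cdiff_M (\<lambda>s. k s $ j) (h t)" for i l t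
    using that by (intro pd_compose[of h t "\<lambda>s. k s $ l"]) auto
  have cX2: "cdiff_M (\<lambda>s. X2 (h s) $ a $ b) t"
    if "\<forall>j. cdiff_M (\<lambda>s. h s $ j) t" "\<forall>a b. cdiff_M (\<lambda>s. X2 s $ a $ b) (h t)" for a b t
    using that by (intro cdiff_M_compose[of h t "\<lambda>s. X2 s $ a $ b"]) auto
  show ?thesis
    unfolding jet_isomorphism_def
  proof (intro conjI)
    show "biholomorphic_germ (\<lambda>t. k (h t))" by (rule biholomorphic_germ_compose[OF h k])
    show "\<forall>\<^sub>F t in nhds 0. \<forall>a b. cdiff_M (\<lambda>s. (X2 (h s) ** X s) $ a $ b) t"
      using X X2h hc by eventually_elim (intro allI cdiff_M_matrix_mult cX2; simp)
    show "\<forall>\<^sub>F t in nhds 0. invertible (X2 (h t) ** X t)"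
      using invX eventually_compose_filterlim[OF invX2 lim]
      by eventually_elim (simp add: invertible_mult)
    show "\<forall>\<^sub>F t in nhds 0. \<forall>i.
        (\<Sum>j\<in>UNIV. mat (pd i (\<lambda>s. k (h s) $ j) t) ** C j (0, k (h t))) ** (X2 (h t) ** X t)
        - X2 (h t) ** X t ** A i (0, t) = 0"
      using F[THEN conjunct1] F[THEN conjunct2] G0 G1 hc kc
    proof eventually_elim
      case (elim t)
      show ?case
        unfolding dk[OF elim(5,6)]
        by (intro allI, rule jet_gauge_compose_identity(1)[OF elim(1,2,3,4)[rule_format]])
    qed
    show "\<forall>\<^sub>F t in nhds 0. \<forall>i. pd_mat i (\<lambda>t. X2 (h t) ** X t) t
        + (\<Sum>j\<in>UNIV. mat (pd i (\<lambda>s. k (h s) $ j) t) ** zlin (C j) (k (h t))) ** (X2 (h t) ** X t)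
        + (\<Sum>j\<in>UNIV. mat (pd i (\<lambda>s. k (h s) $ j) t) ** C j (0, k (h t))) **
          (X2 (h t) ** Y t + Y2 (h t) ** X t)
        - X2 (h t) ** X t ** zlin (A i) t - (X2 (h t) ** Y t + Y2 (h t) ** X t) ** A i (0, t) = 0"
      using F[THEN conjunct1] F[THEN conjunct2] G0 G1 hc kc X X2h
    proof eventually_elim
      case (elim t)
      have "pd_mat i (\<lambda>t. X2 (h t) ** X t) t =
          (\<Sum>j\<in>UNIV. mat (pd i (\<lambda>s. h s $ j) t) ** pd_mat j X2 (h t)) ** X t
          + X2 (h t) ** pd_mat i X t" for i
        using elim(5,7,8) cX2 by (subst pd_mat_mult) (auto simp: pd_mat_compose)
      then show ?case
        unfolding dk[OF elim(5,6)]
        by (simp only:) (intro allI, rule jet_gauge_compose_identity(2)[OF elim(1,2,3,4)[rule_format]])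
    qed
  qed
qed


subsection \<open>Formal invariance of the order\<close>

text \<open>Differentiating \<open>h(g(s)) = s\<close> in direction \<open>j\<close> writes 1 as a
  combination of the partial derivatives of \<open>h^j\<close>, which therefore cannot all
  vanish.\<close>

lemma biholomorphic_germ_jacobian:
  assumes "biholomorphic_germ h"
  shows "\<forall>\<^sub>F t in nhds 0. \<exists>i. pd i (\<lambda>s. h s $ j) t \<noteq> 0"
proof -
  obtain U V g where h: "0 \<in> U" "h ` U = V" "\<And>s. s \<in> V \<Longrightarrow> h (g s) = s"
    "\<And>t. t \<in> U \<Longrightarrow> g (h t) = t" "open U" "open V"
    "\<And>t i. t \<in> U \<Longrightarrow> cdiff_M (\<lambda>t. h t $ i) t" "\<And>s i. s \<in> V \<Longrightarrow> cdiff_M (\<lambda>s. g s $ i) s"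
    using assms unfolding biholomorphic_germ_def holM_on_iff by metis
  have "\<exists>i. pd i (\<lambda>s. h s $ j) t \<noteq> 0" if t: "t \<in> U" for t
  proof -
    have ht: "h t \<in> V" using h(2) t by blast
    have ev: "\<forall>\<^sub>F s in nhds (h t). h (g s) $ j = s $ j"
      using eventually_nhds_in_open[OF h(6) ht] by eventually_elim (simp add: h(3))
    have "pd j (\<lambda>s. h (g s) $ j) (h t) = 1"
      using pd_cong_ev[OF ev, of j] by (simp add: pd_nth)
    moreover have "pd j (\<lambda>s. h (g s) $ j) (h t) =
        (\<Sum>i\<in>UNIV. pd j (\<lambda>s. g s $ i) (h t) * pd i (\<lambda>s. h s $ j) (g (h t)))"
      using h(4)[OF t] h(7)[OF t] h(8)[OF ht] by (intro pd_compose[of g "h t" "\<lambda>s. h s $ j"]) simp_all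
    ultimately have *: "(\<Sum>i\<in>UNIV. pd j (\<lambda>s. g s $ i) (h t) * pd i (\<lambda>s. h s $ j) t) = 1"
      using h(4)[OF t] by simp
    show ?thesis
    proof (rule ccontr)
      assume "\<not> ?thesis"
      with * show False by simp
    qed
  qed
  then show ?thesis using eventually_nhds_in_open[OF h(5,1)] by (auto elim: eventually_mono)
qed

text \<open>The adjugate divided by the determinant; with explicit entries the inverse visibly
  depends holomorphically on the matrix.\<close>

definition inv2 :: "complex^2^2 \<Rightarrow> complex^2^2" where
  "inv2 M = vector [vector [M $ 2 $ 2 / det M, - M $ 1 $ 2 / det M],
                    vector [- M $ 2 $ 1 / det M, M $ 1 $ 1 / det M]]"

lemma inv2:
  assumes "invertible M"
  shows "inv2 M ** M = mat 1" "M ** inv2 M = mat 1"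
proof -
  have d: "det M \<noteq> 0" using assms by (simp add: invertible_det_nz)
  have d2: "det M = M $ 1 $ 1 * M $ 2 $ 2 - M $ 1 $ 2 * M $ 2 $ 1" by (rule det_2)
  show "inv2 M ** M = mat 1" "M ** inv2 M = mat 1"
    by (rule matrix_2_eqI;
        use d in \<open>simp add: inv2_def matrix_matrix_mult_def mat_def sum_2 field_simps\<close>;
        simp add: d2 algebra_simps)+
qed

lemma cdiff_M_inv2:
  assumes "\<And>a b. cdiff_M (\<lambda>s. X s $ a $ b) t" "invertible (X t)"
  shows "cdiff_M (\<lambda>s. inv2 (X s) $ a $ b) t"
proof -
  have "cdiff_M (\<lambda>s. det (X s)) t"
    unfolding det_2 by (intro cdiff_M_diff cdiff_M_mult assms)
  moreover have "det (X t) \<noteq> 0" using assms(2) by (simp add: invertible_det_nz)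
  ultimately have "cdiff_M (\<lambda>s. X s $ i $ j / det (X s)) t" for i j
    by (intro cdiff_M_divide assms(1))
  moreover from cdiff_M_diff[OF cdiff_M_const this, of 0]
  have "cdiff_M (\<lambda>s. - (X s $ i $ j / det (X s))) t" for i j by simp
  ultimately show ?thesis
    using exhaust_2[of a] exhaust_2[of b] by (auto simp: inv2_def)
qed

lemma matrix_add_rdistrib: "((B + C) ** A) = (B ** A) + (C ** A :: 'a::semiring_1^'n^'m)"
  by (simp add: vec_eq_iff matrix_matrix_mult_def sum.distrib distrib_right)

lemma matrix_diff_ldistrib: "A ** (B - C) = A ** B - (A ** C :: 'a::ring_1^'n^'m)"
  by (simp add: vec_eq_iff matrix_matrix_mult_def sum_subtractf right_diff_distrib)

lemma matrix_diff_rdistrib: "(B - C) ** A = B ** A - (C ** A :: 'a::ring_1^'n^'m)"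
  by (simp add: vec_eq_iff matrix_matrix_mult_def sum_subtractf left_diff_distrib)

lemmas matrix_distribs = matrix_add_ldistrib matrix_add_rdistrib matrix_diff_ldistrib
  matrix_diff_rdistrib

text \<open>\<open>S\<close> is the jet of the isomorphism from \<open>P, Q\<close> to \<open>P', Q'\<close> obtained by composing
  the one with jet \<open>(S X, W)\<close> with the inverse of the one with jet \<open>(X, Y)\<close>.\<close>

lemma jet_gauge_quotient:
  fixes X Y W S J dX dS P P' Q Q' A0 A1 :: "complex^2^2"
  assumes inv: "X ** J = mat 1"
    and E0: "P ** X - X ** A0 = 0"
    and E1: "dX + Q ** X + P ** Y - X ** A1 - Y ** A0 = 0"
    and F0: "P' ** (S ** X) - (S ** X) ** A0 = 0"
    and F1: "(dS ** X + S ** dX) + Q' ** (S ** X) + P' ** W - (S ** X) ** A1 - W ** A0 = 0"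
  obtains V where "P' ** S = S ** P" "dS + Q' ** S - S ** Q + (P' ** V - V ** P) = 0"
proof -
  have J: "J ** X = mat 1" using inv matrix_left_right_inverse by blast
  have "P' ** S ** X = S ** P ** X"
    using E0 F0 by (simp add: matrix_mul_assoc[symmetric])
  then have "P' ** S ** X ** J = S ** P ** X ** J" by simp
  then have PS: "P' ** S = S ** P" by (simp add: matrix_mul_assoc[symmetric] inv)
  \<comment> \<open>Multiplying \<open>P X = X A0\<close> by the inverse on both sides moves
    \<open>A0\<close> past \<open>J\<close>, so that the source can be eliminated.\<close>
  have "J ** (P ** X) ** J = J ** (X ** A0) ** J" using E0 by simp
  then have "J ** P ** (X ** J) = (J ** X) ** A0 ** J" by (simp add: matrix_mul_assoc)
  then have A0J: "A0 ** J = J ** P" by (simp add: inv J)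
  \<comment> \<open>The linear coefficient of \<open>(S X + z W)(X + z Y)^(-1)\<close>, whose
    constant coefficient is \<open>S\<close>.\<close>
  define V where "V = (W - S ** Y) ** J"
  have "((dS ** X + S ** dX) + Q' ** (S ** X) + P' ** W - (S ** X) ** A1 - W ** A0)
      - S ** (dX + Q ** X + P ** Y - X ** A1 - Y ** A0) = 0" by (simp only: E1 F1) simp
  then have "(dS + Q' ** S - S ** Q) ** X + P' ** (W - S ** Y) - (W - S ** Y) ** A0 = 0"
    by (simp add: matrix_distribs matrix_mul_assoc PS algebra_simps)
  then have "((dS + Q' ** S - S ** Q) ** X + P' ** (W - S ** Y) - (W - S ** Y) ** A0) ** J = 0"
    by simp
  then have "(dS + Q' ** S - S ** Q) ** (X ** J) + P' ** V - (W - S ** Y) ** (A0 ** J) = 0"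
    by (simp add: matrix_distribs matrix_mul_assoc V_def)
  then have "dS + Q' ** S - S ** Q + (P' ** V - V ** P) = 0"
    by (simp add: inv A0J V_def matrix_mul_assoc algebra_simps)
  with PS show thesis by (rule that)
qed

section \<open>Jets between two normal forms\<close>

lemma higgs_normal_form:
  "(\<Sum>j\<in>UNIV. mat (c j) ** normal_form f j (0, t)) = vector [vector [c 1, 0], vector [c 2, c 1]]"
  by (rule matrix_2_eqI)
    (simp_all add: normal_form_1 normal_form_2 sum_2 matrix_matrix_mult_def mat_def)

text \<open>In the normal form \<open>f\<close> is multiplied by \<open>z\<close>, so the linear
  coefficient of the connection matrix carries exactly \<open>f(0)\<close>.\<close>

lemma zlin_normal_form:
  assumes "f (t $ 2) field_differentiable (at 0)"
  shows "(\<Sum>j\<in>UNIV. mat (c j) ** zlin (normal_form f j) t)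
    = vector [vector [0, c 2 * f (t $ 2) 0], vector [0, 0]]"
proof -
  have "((\<lambda>z. z * f (t $ 2) z) has_field_derivative f (t $ 2) 0) (at 0)"
    using field_differentiable_derivI[OF assms] by (auto intro!: derivative_eq_intros)
  then have "deriv (\<lambda>z. z * f (t $ 2) z) 0 = f (t $ 2) 0" by (rule DERIV_imp_deriv)
  then show ?thesis
    by (intro matrix_2_eqI)
      (simp_all add: zlin_def normal_form_1 normal_form_2 sum_2 matrix_matrix_mult_def mat_def)
qed

text \<open>Different eigenvalues \<open>m'\<close> and \<open>m\<close> would make the first row of
  \<open>S\<close> vanish, contradicting invertibility. Once they agree, the scalar parts cancel and
  \<open>S\<close> intertwines the nilpotent parts.\<close>

lemma triangular_intertwiner:
  fixes S :: "complex^2^2"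
  assumes "vector [vector [m', 0], vector [q, m']] ** S = S ** vector [vector [m, 0], vector [p, m]]"
    and "invertible S"
  shows "m' = m" "p * S $ 1 $ 2 = 0" "q * S $ 1 $ 1 = p * S $ 2 $ 2"
proof -
  have d: "S $ 1 $ 1 * S $ 2 $ 2 - S $ 1 $ 2 * S $ 2 $ 1 \<noteq> 0"
    using assms(2) by (simp add: invertible_det_nz det_2)
  have e: "m' * S $ 1 $ 1 = S $ 1 $ 1 * m + S $ 1 $ 2 * p" "m' * S $ 1 $ 2 = S $ 1 $ 2 * m"
    "q * S $ 1 $ 1 + m' * S $ 2 $ 1 = S $ 2 $ 1 * m + S $ 2 $ 2 * p"
    using arg_cong[OF assms(1), of "\<lambda>M. M $ 1 $ 1"] arg_cong[OF assms(1), of "\<lambda>M. M $ 1 $ 2"]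
      arg_cong[OF assms(1), of "\<lambda>M. M $ 2 $ 1"]
    by (simp_all add: matrix_matrix_mult_def sum_2)
  show m: "m' = m"
  proof (rule ccontr)
    assume "m' \<noteq> m"
    then have "S $ 1 $ 2 = 0" using e(2) by (simp add: mult.commute)
    moreover from this have "S $ 1 $ 1 = 0" using e(1) \<open>m' \<noteq> m\<close> by (simp add: mult.commute)
    ultimately show False using d by simp
  qed
  show "p * S $ 1 $ 2 = 0" "q * S $ 1 $ 1 = p * S $ 2 $ 2"
    using e(1,3) unfolding m by (simp_all add: algebra_simps)
qed

text \<open>The quotient \<open>S\<close> of the two jets eliminates \<open>A\<close>. Its diagonal
  entries are \<open>\<alpha>\<close> and \<open>\<beta>\<close>: the constant terms relate the
  differentials of the second coordinates by the factor \<open>\<beta>/\<alpha>\<close>, and the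
  linear terms relate the values of \<open>f(0)\<close> and \<open>g(0)\<close>.\<close>

lemma jet_isomorphism_normal_forms:
  assumes f: "germ_t2z f" and g: "germ_t2z g"
    and jf: "jet_isomorphism A (normal_form f) h X Y" and jg: "jet_isomorphism A (normal_form g) k Z W"
  obtains \<alpha> \<beta> where "\<forall>\<^sub>F t in nhds 0. cdiff_M \<alpha> t \<and> \<alpha> t \<noteq> 0" "\<forall>\<^sub>F t in nhds 0. cdiff_M \<beta> t \<and> \<beta> t \<noteq> 0"
    "\<forall>\<^sub>F t in nhds 0. \<forall>i. pd i (\<lambda>s. k s $ 2) t * \<alpha> t = pd i (\<lambda>s. h s $ 2) t * \<beta> t"
    "\<forall>\<^sub>F t in nhds 0. f (h t $ 2) 0 * (\<alpha> t)\<^sup>2 = g (k t $ 2) 0 * (\<beta> t)\<^sup>2"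
proof -
  note jf' = jf[unfolded jet_isomorphism_def] and jg' = jg[unfolded jet_isomorphism_def]
  define S where "S t = Z t ** inv2 (X t)" for t
  have h: "biholomorphic_germ h" and k: "biholomorphic_germ k" using jf' jg' by blast+
  have base: "\<forall>\<^sub>F t in nhds 0. (\<forall>a b. cdiff_M (\<lambda>s. X s $ a $ b) t) \<and> invertible (X t) \<and>
      (\<forall>a b. cdiff_M (\<lambda>s. Z s $ a $ b) t) \<and> invertible (Z t)"
    using jf' jg' by (intro eventually_conj) blast+
  have fd: "\<forall>\<^sub>F t in nhds 0. u (l t $ 2) field_differentiable (at 0)"
    if "germ_t2z u" "biholomorphic_germ l" for u l
  proof -
    have "\<forall>\<^sub>F p in nhds 0. cdiff_CM (\<lambda>p. u (snd p $ 2) (fst p)) p"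
      using that by (simp add: germ_t2z_iff)
    from eventually_compose_filterlim[OF eventually_nhds_0_line[OF this] biholomorphic_germ_filterlim[OF that(2)]]
    show ?thesis by eventually_elim (auto dest: cdiff_CM_slice)
  qed
  have S: "\<forall>\<^sub>F t in nhds 0. (\<forall>a b. cdiff_M (\<lambda>s. S s $ a $ b) t) \<and> invertible (S t) \<and> S t ** X t = Z t"
    using base
  proof eventually_elim
    case (elim t)
    have "invertible (inv2 (X t))" using inv2[of "X t"] elim invertible_def by blast
    then show ?case using elim inv2[of "X t"]
      by (auto simp: S_def invertible_mult matrix_mul_assoc[symmetric]
          intro!: cdiff_M_matrix_mult cdiff_M_inv2)
  qed
  \<comment> \<open>The factorization \<open>Z = S X\<close> is going to be differentiated, so it
    must hold on a whole neighbourhood of the point.\<close>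
  have S_near: "\<forall>\<^sub>F t in nhds 0. \<forall>\<^sub>F s in nhds t. S s ** X s = Z s"
    using S by (simp add: eventually_eventually eventually_conj_iff)
  have main: "\<forall>\<^sub>F t in nhds 0. \<forall>i. \<exists>V.
      vector [vector [pd i (\<lambda>s. k s $ 1) t, 0], vector [pd i (\<lambda>s. k s $ 2) t, pd i (\<lambda>s. k s $ 1) t]] ** S t
      = S t ** vector [vector [pd i (\<lambda>s. h s $ 1) t, 0], vector [pd i (\<lambda>s. h s $ 2) t, pd i (\<lambda>s. h s $ 1) t]] \<and>
      pd_mat i S t + vector [vector [0, pd i (\<lambda>s. k s $ 2) t * g (k t $ 2) 0], vector [0, 0]] ** S t
      - S t ** vector [vector [0, pd i (\<lambda>s. h s $ 2) t * f (h t $ 2) 0], vector [0, 0]]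
      + (vector [vector [pd i (\<lambda>s. k s $ 1) t, 0], vector [pd i (\<lambda>s. k s $ 2) t, pd i (\<lambda>s. k s $ 1) t]] ** V
      - V ** vector [vector [pd i (\<lambda>s. h s $ 1) t, 0], vector [pd i (\<lambda>s. h s $ 2) t, pd i (\<lambda>s. h s $ 1) t]]) = 0"
    using base S S_near fd[OF f h] fd[OF g k]
      jf'[THEN conjunct2, THEN conjunct2, THEN conjunct2, THEN conjunct1]
      jf'[THEN conjunct2, THEN conjunct2, THEN conjunct2, THEN conjunct2]
      jg'[THEN conjunct2, THEN conjunct2, THEN conjunct2, THEN conjunct1]
      jg'[THEN conjunct2, THEN conjunct2, THEN conjunct2, THEN conjunct2]
  proof eventually_elim
    case (elim t)
    have SX: "S t ** X t = Z t" using elim(2) by blast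
    show ?case
    proof
      fix i
      have dZ: "pd_mat i Z t = pd_mat i S t ** X t + S t ** pd_mat i X t"
      proof -
        have "pd_mat i Z t = pd_mat i (\<lambda>s. S s ** X s) t"
          by (rule pd_mat_cong_ev) (use elim(3) in \<open>simp add: eq_commute\<close>)
        then show ?thesis using elim(1,2) by (simp add: pd_mat_mult)
      qed
      note E = elim(6,7)[THEN spec[of _ i], unfolded higgs_normal_form zlin_normal_form[of f "h t", OF elim(4)]]
      note F = elim(8,9)[THEN spec[of _ i],
          unfolded higgs_normal_form zlin_normal_form[of g "k t", OF elim(5)] dZ SX[symmetric]]
      show "\<exists>V.
        vector [vector [pd i (\<lambda>s. k s $ 1) t, 0], vector [pd i (\<lambda>s. k s $ 2) t, pd i (\<lambda>s. k s $ 1) t]] ** S t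
        = S t ** vector [vector [pd i (\<lambda>s. h s $ 1) t, 0], vector [pd i (\<lambda>s. h s $ 2) t, pd i (\<lambda>s. h s $ 1) t]] \<and>
        pd_mat i S t + vector [vector [0, pd i (\<lambda>s. k s $ 2) t * g (k t $ 2) 0], vector [0, 0]] ** S t
        - S t ** vector [vector [0, pd i (\<lambda>s. h s $ 2) t * f (h t $ 2) 0], vector [0, 0]]
        + (vector [vector [pd i (\<lambda>s. k s $ 1) t, 0], vector [pd i (\<lambda>s. k s $ 2) t, pd i (\<lambda>s. k s $ 1) t]] ** V
        - V ** vector [vector [pd i (\<lambda>s. h s $ 1) t, 0], vector [pd i (\<lambda>s. h s $ 2) t, pd i (\<lambda>s. h s $ 1) t]]) = 0"
        by (rule jet_gauge_quotient[OF inv2(2)[of "X t"] E F]) (use elim(1) in blast)+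
    qed
  qed
  have tri: "\<forall>\<^sub>F t in nhds 0. S t $ 1 $ 2 = 0 \<and> invertible (S t) \<and>
      (\<forall>i. pd i (\<lambda>s. k s $ 1) t = pd i (\<lambda>s. h s $ 1) t) \<and>
      (\<forall>i. pd i (\<lambda>s. k s $ 2) t * S t $ 1 $ 1 = pd i (\<lambda>s. h s $ 2) t * S t $ 2 $ 2)"
    using main S biholomorphic_germ_jacobian[OF h, of 2]
  proof eventually_elim
    case (elim t)
    note tri = triangular_intertwiner[OF _ elim(2)[THEN conjunct2, THEN conjunct1]]
    have e: "vector [vector [pd i (\<lambda>s. k s $ 1) t, 0], vector [pd i (\<lambda>s. k s $ 2) t, pd i (\<lambda>s. k s $ 1) t]] ** S t
      = S t ** vector [vector [pd i (\<lambda>s. h s $ 1) t, 0], vector [pd i (\<lambda>s. h s $ 2) t, pd i (\<lambda>s. h s $ 1) t]]" for i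
      using elim(1) by blast
    \<comment> \<open>In a direction where the derivative of \<open>h^2\<close> is nonzero, the
      relation \<open>p * S $ 1 $ 2 = 0\<close> forces the upper right entry to vanish.\<close>
    from elim(3) obtain i where "pd i (\<lambda>s. h s $ 2) t \<noteq> 0" by blast
    then show ?case using tri[OF e] elim(2) by auto
  qed
  have nz: "S t $ 1 $ 1 \<noteq> 0 \<and> S t $ 2 $ 2 \<noteq> 0" if "S t $ 1 $ 2 = 0" "invertible (S t)" for t
    using that by (auto simp: invertible_det_nz det_2)
  have "\<forall>\<^sub>F t in nhds 0. cdiff_M (\<lambda>t. S t $ 1 $ 1) t \<and> S t $ 1 $ 1 \<noteq> 0"
    "\<forall>\<^sub>F t in nhds 0. cdiff_M (\<lambda>t. S t $ 2 $ 2) t \<and> S t $ 2 $ 2 \<noteq> 0"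
    using S tri by (eventually_elim, simp add: nz)+
  moreover have "\<forall>\<^sub>F t in nhds 0. \<forall>i. pd i (\<lambda>s. k s $ 2) t * S t $ 1 $ 1 = pd i (\<lambda>s. h s $ 2) t * S t $ 2 $ 2"
    using tri by eventually_elim simp
  moreover have "\<forall>\<^sub>F t in nhds 0. \<forall>\<^sub>F s in nhds t. S s $ 1 $ 2 = 0"
    using tri by (simp add: eventually_eventually eventually_conj_iff)
  then have "\<forall>\<^sub>F t in nhds 0. f (h t $ 2) 0 * (S t $ 1 $ 1)\<^sup>2 = g (k t $ 2) 0 * (S t $ 2 $ 2)\<^sup>2"
    using main tri biholomorphic_germ_jacobian[OF h, of 2]
  proof eventually_elim
    case (elim t)
    from elim(4) obtain i where p: "pd i (\<lambda>s. h s $ 2) t \<noteq> 0" by blast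
    from elim(2) obtain V where V: "pd_mat i S t
      + vector [vector [0, pd i (\<lambda>s. k s $ 2) t * g (k t $ 2) 0], vector [0, 0]] ** S t
      - S t ** vector [vector [0, pd i (\<lambda>s. h s $ 2) t * f (h t $ 2) 0], vector [0, 0]]
      + (vector [vector [pd i (\<lambda>s. k s $ 1) t, 0], vector [pd i (\<lambda>s. k s $ 2) t, pd i (\<lambda>s. k s $ 1) t]] ** V
      - V ** vector [vector [pd i (\<lambda>s. h s $ 1) t, 0], vector [pd i (\<lambda>s. h s $ 2) t, pd i (\<lambda>s. h s $ 1) t]]) = 0"
      by blast
    \<comment> \<open>The entry vanishes near the point and not only at it, so its derivative
      vanishes as well.\<close>
    have "pd_mat i S t $ 1 $ 2 = 0"
      using pd_cong_ev[OF elim(1), of i] by (simp add: pd_mat_def)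
    \<comment> \<open>The unknown \<open>V\<close> drops out of the upper right entry: both Higgs
      matrices are lower triangular with the same diagonal value, so \<open>V $ 1 $ 2\<close>
      appears twice with opposite signs.\<close>
    then have "pd i (\<lambda>s. k s $ 2) t * g (k t $ 2) 0 * S t $ 2 $ 2
        = pd i (\<lambda>s. h s $ 2) t * f (h t $ 2) 0 * S t $ 1 $ 1"
      using arg_cong[OF V, of "\<lambda>M. M $ 1 $ 2"] elim(3)
      by (simp add: matrix_matrix_mult_def sum_2 mult_ac)
    then have "(pd i (\<lambda>s. k s $ 2) t * S t $ 1 $ 1) * g (k t $ 2) 0 * S t $ 2 $ 2
        = pd i (\<lambda>s. h s $ 2) t * f (h t $ 2) 0 * (S t $ 1 $ 1)\<^sup>2"
      by (simp add: power2_eq_square mult_ac)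
    also have "pd i (\<lambda>s. k s $ 2) t * S t $ 1 $ 1 = pd i (\<lambda>s. h s $ 2) t * S t $ 2 $ 2"
      using elim(3) by blast
    finally have "pd i (\<lambda>s. h s $ 2) t * (g (k t $ 2) 0 * (S t $ 2 $ 2)\<^sup>2)
        = pd i (\<lambda>s. h s $ 2) t * (f (h t $ 2) 0 * (S t $ 1 $ 1)\<^sup>2)"
      by (simp only: power2_eq_square mult.assoc mult.left_commute mult.commute)
    then show ?case using p by simp
  qed
  ultimately show thesis by (rule that)
qed

text \<open>Writing \<open>F = X^n H\<close> with a unit \<open>H\<close>, the composite is the
  product of the unit \<open>H(G)\<close> and \<open>G^n\<close>, which has order \<open>n\<close>
  because \<open>G\<close> has order one.\<close>

lemma subdegree_compose_order_1:
  fixes F G :: "complex fps"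
  assumes "fps_nth G 0 = 0" "fps_nth G 1 \<noteq> 0"
  shows "fps_compose F G = 0 \<longleftrightarrow> F = 0" "subdegree (fps_compose F G) = subdegree F"
proof -
  have G: "G \<noteq> 0" "subdegree G = 1" using assms by (auto intro!: subdegreeI)
  have *: "fps_compose F G \<noteq> 0 \<and> subdegree (fps_compose F G) = subdegree F" if "F \<noteq> 0"
  proof -
    define n where "n = subdegree F"
    define H where "H = fps_shift n F"
    have F: "F = H * fps_X ^ n" using subdegree_decompose[of F] by (simp add: H_def n_def)
    have H0: "fps_nth H 0 \<noteq> 0" using nth_subdegree_nonzero[OF that] by (simp add: H_def n_def)
    have HG: "fps_nth (fps_compose H G) 0 \<noteq> 0" using H0 by (simp add: fps_compose_nth)
    then have "fps_compose H G \<noteq> 0" by (metis fps_zero_nth)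
    moreover have "subdegree (fps_compose H G) = 0" using HG by (simp only: subdegree_eq_0_iff) simp
    moreover have "fps_compose F G = fps_compose H G * G ^ n"
      unfolding F using assms(1)
      by (simp add: fps_compose_mult_distrib fps_X_power_compose)
    ultimately show ?thesis using G by (simp add: n_def)
  qed
  show "fps_compose F G = 0 \<longleftrightarrow> F = 0" using * by (cases "F = 0") auto
  show "subdegree (fps_compose F G) = subdegree F" using * by (cases "F = 0") auto
qed

lemma ord0_compose_mult:
  assumes F: "F analytic_on {0}" and h: "h analytic_on {0}" "h 0 = 0" "deriv h 0 \<noteq> 0"
    and u: "u analytic_on {0}" "u 0 \<noteq> 0"
  shows "ord0 (\<lambda>s. F (h s) * u s) = ord0 F"
proof -
  define F' where "F' = fps_expansion F 0"
  define H where "H = fps_expansion h 0"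
  define V where "V = fps_expansion u 0"
  have exp: "F has_fps_expansion F'" "h has_fps_expansion H" "u has_fps_expansion V"
    unfolding F'_def H_def V_def using F h(1) u(1) by (auto intro: analytic_at_imp_has_fps_expansion_0)
  have H: "fps_nth H 0 = 0" "fps_nth H 1 \<noteq> 0"
    using h by (simp_all add: H_def fps_expansion_def)
  have V0: "fps_nth V 0 \<noteq> 0" using u by (simp add: V_def fps_expansion_def)
  then have V: "V \<noteq> 0" "subdegree V = 0" by (auto simp: subdegree_eq_0_iff)
  have "(\<lambda>s. (F \<circ> h) s * u s) has_fps_expansion fps_compose F' H * V"
    by (intro has_fps_expansion_mult has_fps_expansion_compose exp H)
  then have "fps_expansion (\<lambda>s. F (h s) * u s) 0 = fps_compose F' H * V"
    by (simp add: fps_expansion_eqI o_def)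
  then show ?thesis
    using V subdegree_compose_order_1[OF H, of F']
    by (auto simp: ord0_def F'_def[symmetric])
qed

lemma ord0_cong:
  assumes "\<forall>\<^sub>F s in nhds 0. F s = G s"
  shows "ord0 F = ord0 G"
proof -
  have "fps_expansion F 0 = fps_expansion G 0"
    unfolding fps_expansion_def using assms by (simp add: fps_eq_iff higher_deriv_cong_ev[OF _ refl])
  then show ?thesis by (simp add: ord0_def)
qed

text \<open>Both normal forms are reached from \<open>A\<close>: the one of \<open>f\<close>
  directly, the one of \<open>g\<close> through the formal isomorphism to \<open>B\<close>. The two
  resulting 1-jets have a common source and can be compared.\<close>

lemma ord0_formal_invariant:
  assumes A: "T_structure A" and B: "T_structure B" and AB: "formally_isomorphic A B"
    and f: "associated f A" and g: "associated g B"
  shows "ord0 (zcoeff f 0) = ord0 (zcoeff g 0)"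
proof -
  have gA: "germ_tz (\<lambda>p. A i p $ a $ b)" and gB: "germ_tz (\<lambda>p. B i p $ a $ b)" for i a b
    using A B by (simp_all add: T_structure_def)
  have ff: "germ_t2z f" and gg: "germ_t2z g" using f g by (simp_all add: associated_def)
  have gN: "germ_tz (\<lambda>p. normal_form u i p $ a $ b)" if "germ_t2z u" for u i a b
    unfolding germ_tz_iff using that[unfolded germ_t2z_iff]
  proof eventually_elim
    case (elim p)
    have "cdiff_CM (\<lambda>p. c) p" for c using cdiff_CM_snd[of "\<lambda>_. c" p] by simp
    moreover have "cdiff_CM (\<lambda>p. fst p * u (snd p $ 2) (fst p)) p"
      by (intro cdiff_CM_mult cdiff_CM_fst elim)
    ultimately show ?case
      using exhaust_2[of i] exhaust_2[of a] exhaust_2[of b]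
      by (auto simp: normal_form_1 normal_form_2)
  qed
  obtain h T where "hol_isomorphism A (normal_form f) h T"
    using f unfolding associated_def hol_isomorphic_def by blast
  note jf = jet_isomorphism_hol[OF this gA gN[OF ff]]
  obtain l R where "formal_isomorphism A B l R"
    using AB unfolding formally_isomorphic_def by blast
  note jAB = jet_isomorphism_formal[OF this]
  obtain l' R' where "hol_isomorphism B (normal_form g) l' R'"
    using g unfolding associated_def hol_isomorphic_def by blast
  note jB = jet_isomorphism_hol[OF this gB gN[OF gg]]
  define k where "k t = l' (l t)" for t
  note jg = jet_isomorphism_compose[OF jAB jB, folded k_def]
  have h: "biholomorphic_germ h" and k: "biholomorphic_germ k"
    using jf jg unfolding jet_isomorphism_def by blast+
  obtain \<alpha> \<beta> where \<alpha>: "\<forall>\<^sub>F t in nhds 0. cdiff_M \<alpha> t \<and> \<alpha> t \<noteq> 0"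
    and \<beta>: "\<forall>\<^sub>F t in nhds 0. cdiff_M \<beta> t \<and> \<beta> t \<noteq> 0"
    and hk: "\<forall>\<^sub>F t in nhds 0. \<forall>i. pd i (\<lambda>s. k s $ 2) t * \<alpha> t = pd i (\<lambda>s. h s $ 2) t * \<beta> t"
    and fg: "\<forall>\<^sub>F t in nhds 0. f (h t $ 2) 0 * (\<alpha> t)\<^sup>2 = g (k t $ 2) 0 * (\<beta> t)\<^sup>2"
    by (rule jet_isomorphism_normal_forms[OF ff gg jf jg]) (rule that)
  \<comment> \<open>The axis is chosen so that \<open>h^2\<close>, restricted to it, is a local
    coordinate.\<close>
  obtain i where hi: "pd i (\<lambda>s. h s $ 2) 0 \<noteq> 0"
    using eventually_nhds_x_imp_x[OF biholomorphic_germ_jacobian[OF h, of 2]] by blast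
  have nz: "\<alpha> 0 \<noteq> 0" "\<beta> 0 \<noteq> 0"
    using eventually_nhds_x_imp_x[OF \<alpha>] eventually_nhds_x_imp_x[OF \<beta>] by auto
  \<comment> \<open>The same axis suits \<open>k\<close>: along it the derivatives of the second
    components differ by the nonzero factor \<open>\<beta>/\<alpha>\<close>.\<close>
  have ki: "pd i (\<lambda>s. k s $ 2) 0 \<noteq> 0"
    using eventually_nhds_x_imp_x[OF hk] hi nz by (metis mult_eq_0_iff)
  have an: "(\<lambda>w. \<alpha> (axis i w)) analytic_on {0}" "(\<lambda>w. \<beta> (axis i w)) analytic_on {0}"
    using \<alpha> \<beta> by (auto intro!: analytic_along_axis elim: eventually_mono)
  have an_h: "(\<lambda>w. h (axis i w) $ 2) analytic_on {0}" "(\<lambda>w. k (axis i w) $ 2) analytic_on {0}"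
    using biholomorphic_germ_cdiff[OF h] biholomorphic_germ_cdiff[OF k]
    by (auto intro!: analytic_along_axis[of "\<lambda>t. _ t $ 2"] elim: eventually_mono)
  have axis0: "axis i (0 :: complex) = 0" by (simp add: vec_eq_iff axis_def)
  have h0: "h 0 = 0" "k 0 = 0" using h k by (simp_all add: biholomorphic_germ_def)
  have d: "deriv (\<lambda>w. h (axis i w) $ 2) 0 \<noteq> 0" "deriv (\<lambda>w. k (axis i w) $ 2) 0 \<noteq> 0"
    using hi ki by (simp_all add: pd_def)
  \<comment> \<open>Restricted to the axis, each side of the relation between \<open>f(0)\<close>
    and \<open>g(0)\<close> is a function of a local coordinate times the square of a unit, so
    neither operation changes the order.\<close>
  have "ord0 (zcoeff f 0) = ord0 (\<lambda>w. zcoeff f 0 (h (axis i w) $ 2) * (\<alpha> (axis i w))\<^sup>2)"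
    by (rule ord0_compose_mult[symmetric])
      (use d an_h nz in \<open>auto simp: axis0 h0 intro!: germ_t2z_analytic_zcoeff[OF ff] analytic_on_power an\<close>)
  also have "\<dots> = ord0 (\<lambda>w. zcoeff g 0 (k (axis i w) $ 2) * (\<beta> (axis i w))\<^sup>2)"
    using eventually_compose_filterlim[OF fg filterlim_axis]
    by (intro ord0_cong) (simp add: zcoeff_0)
  also have "\<dots> = ord0 (zcoeff g 0)"
    by (rule ord0_compose_mult)
      (use d an_h nz in \<open>auto simp: axis0 h0 intro!: germ_t2z_analytic_zcoeff[OF gg] analytic_on_power an\<close>)
  finally show ?thesis .
qed

theorem theorem19:
  fixes A :: matrix_pair
  assumes "T_structure_over_N2 A"
  shows "(\<forall>B f g. T_structure_over_N2 B \<and> formally_isomorphic A B \<and> associated f A \<and> associated g B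
            \<longrightarrow> ord0 (zcoeff f 0) = ord0 (zcoeff g 0)) \<and>
         (\<forall>g. associated g A \<and> (\<forall>\<^sub>F s in nhds 0. zcoeff g 0 s = 0) \<longrightarrow>
            (\<exists>f. associated f A \<and> (\<forall>\<^sub>F s in nhds 0. zcoeff f 0 s = 0) \<and>
                 (\<forall>\<^sub>F s in nhds 0. zcoeff f 1 s = 0))) \<and>
         (\<forall>g r. associated g A \<and> ord0 (zcoeff g 0) = enat r \<longrightarrow>
            (\<exists>f. associated f A \<and> (\<forall>\<^sub>F s in nhds 0. zcoeff f 0 s = s ^ r)))"
proof (intro conjI allI impI; elim conjE)
  show "ord0 (zcoeff f 0) = ord0 (zcoeff g 0)"
    if "T_structure_over_N2 B" "formally_isomorphic A B" "associated f A" "associated g B" for B f g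
    using that assms by (intro ord0_formal_invariant) (auto simp: T_structure_over_N2_def)
  show "\<exists>f. associated f A \<and> (\<forall>\<^sub>F s in nhds 0. zcoeff f 0 s = 0) \<and> (\<forall>\<^sub>F s in nhds 0. zcoeff f 1 s = 0)"
    if "associated g A" "\<forall>\<^sub>F s in nhds 0. zcoeff g 0 s = 0" for g
    using associated_vanishing[OF that] by blast
  show "\<exists>f. associated f A \<and> (\<forall>\<^sub>F s in nhds 0. zcoeff f 0 s = s ^ r)"
    if "associated g A" "ord0 (zcoeff g 0) = enat r" for g r
    using associated_monomial[OF that] by blast
qed

end
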